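(* Suppose there are $x^*\in X^*$ and constants $\mathcal L<\infty$, $\sigma_*$ such that for all $x\in X$ and all $t$ $$\mathbb E_{\xi_{t,1}}\big[\|\mathcal G(x,\xi_{t,1})-g(x)\|_*^2\big]\le \mathcal L\,[f(x)-f^*-\langle g(x^* ),x-x^*\rangle]+\sigma_*^2 .$$ Let $k\ge2$, let $D>0$ be such that $V(z_0,x^* )\le D^2$, and let $\{z_t\},\{y_t\},\{x_t\}$ be generated by the SAGD algorithm (see context) with $\beta_t=\frac3{t+2}$, $m_t=m$, $\eta_t=\frac{\eta}{t+1}$, where $$\eta=\max\left\{4L,\ \frac{6(k-1)\mathcal L}{m},\ \sqrt{\frac{9(k+1)^2L\mathcal L}{m}},\ \frac{\sigma_*}{D}\sqrt{\frac{2(k+2)^3}{3m}}\right\}.$$ Then $\mathbb E[V(z_t,x^* )]\le3D^2$ for all $1\le t\le k$, and $$\mathbb E[f(x_k)-f^*]\le\frac{12LD^2}{(k+1)(k+2)}+\frac{18\mathcal LD^2}{(k+2)m}+\frac{18D^2\sqrt{L\mathcal L}}{(k+1)\sqrt m}+\frac{4\sigma_*D\sqrt2}{\sqrt{(k+1)m}} .$$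
   Context: $E$ is a finite-dimensional Euclidean space with inner product $\langle\cdot,\cdot\rangle$, $\|\cdot\|$ is a (not necessarily Euclidean) norm on $E$, and $\|z\|_*=\sup\{\langle x,z\rangle:\|x\|\le 1\}$ is its dual norm. $X\subset E$ is closed and convex, $f:X\to\mathbb R$ is a smooth convex function with gradient $g=\nabla f$ that is Lipschitz continuous in the sense that for some $L\ge 0$: $0\le f(y)-f(x)-\langle g(x),y-x\rangle\le \frac L2\|y-x\|^2$ for all $x,y\in X$. The value $f^*=\min_{x\in X}f(x)$ is attained and $X^*\neq\emptyset$ is the set of minimizers. Stochastic oracle: for $x\in X$ and $\xi\in\Xi$ the oracle returns $\mathcal G(x,\xi)\in E$. The random variables $\xi_{t,i}$ ($t\ge 0$, $1\le i\le m_t$) are mutually independent and, for each $t$, identically distributed, and the oracle is unbiased: $\mathbb E_{\xi_{t,i}}[\mathcal G(x,\xi_{t,i})]=g(x)$ for all $x\in X$. $\omega:E\to\mathbb R$ (the distance generating function) is continuously differentiable and strongly convex with modulus $1$ with respect to $\|\cdot\|$, with $\omega(x)\ge\omega(0)=0$. For a fixed initial point $x_0$, the Bregman divergence is $V(x,y)=V_{x_0}(x,y)=\omega(y-x_0)-\omega(x-x_0)-\langle\nabla\omega(x-x_0),y-x\rangle$. SAGD algorithm (stochastic accelerated gradient descent). Input: a (deterministic) initial point $z_0=x_0\in X$, nonrandom parameters $\beta_t\in[0,1]$ and $\eta_t>0$, and batch sizes $m_t\in\{1,2,\dots\}$. For $t=1,2,\dots$: $$y_t=(1-\beta_t)x_{t-1}+\beta_tz_{t-1},\qquad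 G_t=\frac1{m_t}\sum_{i=1}^{m_t}\mathcal G(y_t,\xi_{t,i}),$$ $$z_t=\operatorname{argmin}_{z\in X}\{\langle G_t,z\rangle+\eta_tV(z_{t-1},z)\},\qquad x_t=(1-\beta_t)x_{t-1}+\beta_tz_t .$$ *)

theory Defs
  imports "HOL-Probability.Probability"
begin

definition norm_fun :: "('a::real_vector \<Rightarrow> real) \<Rightarrow> bool" where
  "norm_fun N \<longleftrightarrow>
     (\<forall>x. 0 \<le> N x) \<and> (\<forall>x. N x = 0 \<longleftrightarrow> x = 0) \<and>
     (\<forall>a x. N (a *\<^sub>R x) = \<bar>a\<bar> * N x) \<and> (\<forall>x y. N (x + y) \<le> N x + N y)"

(* On a Euclidean space the set below is nonempty and bounded for every norm N,
   so that this conditional supremum is the true one. *)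
definition dual_norm :: "('a::euclidean_space \<Rightarrow> real) \<Rightarrow> 'a \<Rightarrow> real" where
  "dual_norm N z = (SUP x\<in>{x. N x \<le> 1}. x \<bullet> z)"

(* For X with empty interior the gradient is not unique, and any choice is admitted. *)
definition gradient_on :: "'a::real_inner set \<Rightarrow> ('a \<Rightarrow> real) \<Rightarrow> ('a \<Rightarrow> 'a) \<Rightarrow> bool" where
  "gradient_on X f g \<longleftrightarrow> (\<forall>x\<in>X. (f has_derivative (\<lambda>h. g x \<bullet> h)) (at x within X))"

definition minimizers :: "'a set \<Rightarrow> ('a \<Rightarrow> real) \<Rightarrow> 'a set" where
  "minimizers X f = {x. is_arg_min f (\<lambda>y. y \<in> X) x}"

definition strongly_convex :: "('a::real_vector \<Rightarrow> real) \<Rightarrow> real \<Rightarrow> ('a \<Rightarrow> real) \<Rightarrow> bool" where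
  "strongly_convex N \<mu> w \<longleftrightarrow>
     (\<forall>x y. \<forall>u\<in>{0..1}.
        w ((1 - u) *\<^sub>R x + u *\<^sub>R y)
          \<le> (1 - u) * w x + u * w y - \<mu> / 2 * u * (1 - u) * (N (x - y))\<^sup>2)"

definition bregman ::
  "('a::real_inner \<Rightarrow> real) \<Rightarrow> ('a \<Rightarrow> 'a) \<Rightarrow> 'a \<Rightarrow> 'a \<Rightarrow> 'a \<Rightarrow> real" where
  "bregman w dw x0 x y = w (y - x0) - w (x - x0) - dw (x - x0) \<bullet> (y - x)"

definition batch_mean ::
  "('a::real_vector \<Rightarrow> 's \<Rightarrow> 'a) \<Rightarrow> nat \<Rightarrow> (nat \<Rightarrow> 's) \<Rightarrow> 'a \<Rightarrow> 'a" where
  "batch_mean Or b s y = (1 / real b) *\<^sub>R (\<Sum>i = 1..b. Or y (s i))"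

(* Pathwise: s is one realisation of the samples (s t i is the i-th sample of step t) and
   z, y, x are the resulting trajectories. *)
definition sagd ::
  "'a::real_inner set \<Rightarrow> ('a \<Rightarrow> 'a \<Rightarrow> real) \<Rightarrow> ('a \<Rightarrow> 's \<Rightarrow> 'a) \<Rightarrow>
   (nat \<Rightarrow> real) \<Rightarrow> (nat \<Rightarrow> real) \<Rightarrow> (nat \<Rightarrow> nat) \<Rightarrow> 'a \<Rightarrow> (nat \<Rightarrow> nat \<Rightarrow> 's) \<Rightarrow>
   (nat \<Rightarrow> 'a) \<Rightarrow> (nat \<Rightarrow> 'a) \<Rightarrow> (nat \<Rightarrow> 'a) \<Rightarrow> bool" where
  "sagd X V Or \<beta> \<eta> m x0 s z y x \<longleftrightarrow>
     z 0 = x0 \<and> x 0 = x0 \<and>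
     (\<forall>t\<ge>1.
        y t = (1 - \<beta> t) *\<^sub>R x (t - 1) + \<beta> t *\<^sub>R z (t - 1) \<and>
        is_arg_min (\<lambda>v. batch_mean Or (m t) (s t) (y t) \<bullet> v + \<eta> t * V (z (t - 1)) v)
          (\<lambda>v. v \<in> X) (z t) \<and>
        x t = (1 - \<beta> t) *\<^sub>R x (t - 1) + \<beta> t *\<^sub>R z t)"

end

theory Submission
  imports Defs
begin

text \<open>One step bounds \<open>f (x t) - f xs + \<beta> \<eta> V (z t) xs\<close> by its predecessor and the noise. Three
  quarters of the divergence \<open>V (z (t - 1)) (z t)\<close> compensate the quadratic error of the smoothness
  inequality, because \<open>4 L \<le> \<eta>\<close>; the last quarter pays for the noise. The prox step is the gradient of
  the conjugate of \<open>w\<close>, which is smooth with respect to the dual norm, so adding the \<open>m\<close> samples one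
  at a time costs martingale increments and the sum of the squared dual norms of the individual
  errors. This gives the factor \<open>1 / m\<close> for every norm. The state-dependent part of the variance at
  \<open>y t\<close> is bounded by convexity through \<open>f (x (t - 1)) - f xs\<close> and \<open>L V (z (t - 1)) xs\<close>. Taking
  expectations yields a scalar recursion in which \<open>E V\<close> grows from \<open>D\<^sup>2\<close> to at most
  \<open>D\<^sup>2 (1 + (h3 / \<eta>)\<^sup>2 + (h4 / \<eta>)\<^sup>2)\<close>, where \<open>h3\<close> and \<open>h4\<close> are the last two terms of the
  maximum \<open>\<eta>\<close>.\<close>

section \<open>Norms on a Euclidean space\<close>

text \<open>The bound \<open>3 * D\<^sup>2\<close> on the expected divergence alone would give
  \<open>9 * \<eta> * D\<^sup>2\<close> over \<open>(k + 1) * (k + 2)\<close>, three times too much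
  in the terms with \<open>L\<close> and \<open>\<L>\<close>. Hence the growth of the divergence is
  tracked through the ratios of the last two terms of the maximum to \<open>\<eta>\<close>. The
  variance contains the expected divergence, which is itself to be bounded. The recursion closes
  because the induction hypothesis supplies the crude bound \<open>3 * D\<^sup>2\<close>, used for
  this noise term only. Neither measurability nor integrability of the trajectories is assumed. By
  strong convexity the prox step has exactly one solution, and this solution is Lipschitz in the
  dual vector, so the iterates are measurable functions of the past samples. Integrability passes
  from step to step, since the pathwise inequality bounds two nonnegative quantities by an
  integrable one. Conditional expectations are replaced by Fubini's theorem for a fresh sample and a
  frozen past.\<close>

locale finite_dim_norm =
  fixes N :: "'a::euclidean_space \<Rightarrow> real"
  assumes norm_fun: "norm_fun N"
begin

lemma N_nonneg: "0 \<le> N x"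
  and N_eq_0_iff: "N x = 0 \<longleftrightarrow> x = 0"
  and N_scale: "N (a *\<^sub>R x) = \<bar>a\<bar> * N x"
  and N_triangle: "N (x + y) \<le> N x + N y"
  using norm_fun by (auto simp: norm_fun_def)

lemma N_minus: "N (- x) = N x"
  using N_scale[of "-1" x] by simp

lemma N_minus_commute: "N (x - y) = N (y - x)"
  using N_minus[of "x - y"] by simp

lemma N_le_norm: obtains C where "0 < C" and "\<And>x. N x \<le> C * norm x"
proof
  let ?C = "(\<Sum>b\<in>Basis. N b) + 1"
  show "0 < ?C"
    by (smt (verit) N_nonneg sum_nonneg)
  fix x
  have sum_le: "N (\<Sum>b\<in>B. h b) \<le> (\<Sum>b\<in>B. N (h b))" if "finite B" for B :: "'a set" and h
    using that
  proof induction
    case empty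
    then show ?case using N_eq_0_iff[of 0] by simp
  next
    case (insert b B)
    then show ?case using N_triangle[of "h b" "\<Sum>b\<in>B. h b"] by simp
  qed
  have "N x = N (\<Sum>b\<in>Basis. (x \<bullet> b) *\<^sub>R b)"
    by (simp add: euclidean_representation)
  also have "\<dots> \<le> (\<Sum>b\<in>Basis. N ((x \<bullet> b) *\<^sub>R b))"
    by (rule sum_le) simp
  also have "\<dots> \<le> (\<Sum>b\<in>Basis. norm x * N b)"
    by (rule sum_mono) (simp add: N_scale N_nonneg Basis_le_norm mult_right_mono)
  also have "\<dots> \<le> ?C * norm x"
    unfolding sum_distrib_left[symmetric] by (simp add: algebra_simps)
  finally show "N x \<le> ?C * norm x" .
qed

lemma continuous_on_N: "continuous_on S N"
proof -
  obtain C where C: "0 < C" "\<And>x. N x \<le> C * norm x"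
    using N_le_norm by blast
  have "C-lipschitz_on S N"
  proof (rule lipschitz_onI)
    fix x y
    have "N x \<le> N (x - y) + N y" "N y \<le> N (y - x) + N x"
      using N_triangle[of "x - y" y] N_triangle[of "y - x" x] by simp_all
    then show "dist (N x) (N y) \<le> C * dist x y"
      using C(2)[of "x - y"] by (simp add: dist_real_def dist_norm N_minus_commute[of y x])
  qed (use C in simp)
  then show ?thesis
    by (rule lipschitz_on_continuous_on)
qed

text \<open>By compactness \<open>N\<close> attains a minimum on the Euclidean unit sphere, which is
  positive by definiteness; homogeneity does the rest. This direction of the norm equivalence makes
  the dual norm finite.\<close>

lemma norm_le_N: obtains c where "0 < c" and "\<And>x. norm x \<le> c * N x"
proof -
  have "sphere (0::'a) 1 \<noteq> {}"
    by (simp add: sphere_eq_empty)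
  then obtain e where e: "e \<in> sphere 0 1" "\<And>x. x \<in> sphere 0 1 \<Longrightarrow> N e \<le> N x"
    using continuous_attains_inf[OF compact_sphere _ continuous_on_N] by metis
  have "N e \<noteq> 0"
    using e(1) by (auto simp: N_eq_0_iff)
  then have pos: "0 < N e"
    using N_nonneg[of e] by linarith
  have "norm x \<le> (1 / N e) * N x" for x
  proof (cases "x = 0")
    case True
    then show ?thesis by (simp add: N_nonneg pos)
  next
    case False
    then have "N e \<le> N ((1 / norm x) *\<^sub>R x)"
      by (intro e(2)) simp
    then show ?thesis
      using False pos by (simp add: N_scale field_simps)
  qed
  then show ?thesis
    using that[of "1 / N e"] pos by simp
qed

lemma bdd_above_dual_norm: "bdd_above ((\<lambda>x. x \<bullet> z) ` {x. N x \<le> 1})"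
proof -
  obtain c where c: "0 < c" "\<And>x. norm x \<le> c * N x"
    using norm_le_N by blast
  have "x \<bullet> z \<le> c * norm z" if "N x \<le> 1" for x
  proof -
    have "norm x \<le> c"
      using c(2)[of x] mult_left_mono[OF that, of c] c(1) by linarith
    then have "norm x * norm z \<le> c * norm z"
      by (rule mult_right_mono) simp
    then show ?thesis
      using norm_cauchy_schwarz[of x z] by linarith
  qed
  then show ?thesis
    by (intro bdd_aboveI[of _ "c * norm z"]) auto
qed

lemma inner_le_dual_norm_1: "N x \<le> 1 \<Longrightarrow> x \<bullet> z \<le> dual_norm N z"
  unfolding dual_norm_def using bdd_above_dual_norm by (intro cSUP_upper) auto

lemma dual_norm_leI: "(\<And>x. N x \<le> 1 \<Longrightarrow> x \<bullet> z \<le> B) \<Longrightarrow> dual_norm N z \<le> B"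
  unfolding dual_norm_def
  by (rule cSUP_least) (use N_eq_0_iff[of 0] in \<open>auto intro!: exI[of _ 0]\<close>)

lemma dual_norm_nonneg: "0 \<le> dual_norm N z"
  using inner_le_dual_norm_1[of 0 z] N_eq_0_iff[of 0] by simp

lemma inner_le_dual_norm: "x \<bullet> z \<le> N x * dual_norm N z"
proof (cases "x = 0")
  case False
  then have "0 < N x"
    using N_nonneg[of x] N_eq_0_iff[of x] by linarith
  then show ?thesis
    using inner_le_dual_norm_1[of "(1 / N x) *\<^sub>R x" z] by (simp add: N_scale field_simps)
next
  case True
  then show ?thesis using N_eq_0_iff[of 0] by simp
qed

lemma dual_norm_triangle: "dual_norm N (y + z) \<le> dual_norm N y + dual_norm N z"
  by (rule dual_norm_leI) (simp add: inner_right_distrib add_mono inner_le_dual_norm_1)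

lemma dual_norm_minus: "dual_norm N (- z) = dual_norm N z"
proof -
  have "dual_norm N (- z) \<le> dual_norm N z" for z
  proof (rule dual_norm_leI)
    fix x assume "N x \<le> 1"
    then show "x \<bullet> - z \<le> dual_norm N z"
      using inner_le_dual_norm_1[of "- x" z] by (simp add: N_minus)
  qed
  from this[of z] this[of "- z"] show ?thesis by simp
qed

lemma dual_norm_scale: "0 < a \<Longrightarrow> dual_norm N (a *\<^sub>R z) = a * dual_norm N z"
proof (rule antisym)
  show le: "dual_norm N (a *\<^sub>R z) \<le> a * dual_norm N z" if "0 < a" for a z
    using that by (intro dual_norm_leI) (simp add: inner_le_dual_norm_1)
  show "a * dual_norm N z \<le> dual_norm N (a *\<^sub>R z)" if "0 < a"
    using le[of "1 / a" "a *\<^sub>R z"] that by (simp add: field_simps)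
qed

lemma dual_norm_le_norm: obtains c where "0 < c" and "\<And>z. dual_norm N z \<le> c * norm z"
proof -
  obtain c where c: "0 < c" "\<And>x. norm x \<le> c * N x"
    using norm_le_N by blast
  have "dual_norm N z \<le> c * norm z" for z
  proof (rule dual_norm_leI)
    fix x assume "N x \<le> 1"
    then have "norm x \<le> c"
      using c(2)[of x] mult_left_mono[of "N x" 1 c] c(1) by linarith
    then have "norm x * norm z \<le> c * norm z"
      by (rule mult_right_mono) simp
    then show "x \<bullet> z \<le> c * norm z"
      using norm_cauchy_schwarz[of x z] by linarith
  qed
  with c(1) that show ?thesis by blast
qed

text \<open>Pairing \<open>z\<close> with itself gives
  \<open>(norm z)\<^sup>2 \<le> N z * dual_norm N z\<close>. Through this bound a finite dual-norm
  variance makes the noise square integrable in the Euclidean norm.\<close>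

lemma norm_le_dual_norm: obtains C where "0 < C" and "\<And>z. norm z \<le> C * dual_norm N z"
proof -
  obtain C where C: "0 < C" "\<And>x. N x \<le> C * norm x"
    using N_le_norm by blast
  have "norm z \<le> C * dual_norm N z" for z
  proof -
    have "norm z * norm z \<le> N z * dual_norm N z"
      using inner_le_dual_norm[of z z] by (simp add: power2_norm_eq_inner[symmetric] power2_eq_square)
    also have "\<dots> \<le> C * norm z * dual_norm N z"
      by (rule mult_right_mono[OF C(2) dual_norm_nonneg])
    finally have "norm z * norm z \<le> norm z * (C * dual_norm N z)"
      by (simp add: ac_simps)
    then show ?thesis
      by (cases "z = 0") (simp_all add: C(1) dual_norm_nonneg less_imp_le)
  qed
  with C(1) that show ?thesis by blast
qed

lemma continuous_on_dual_norm: "continuous_on S (dual_norm N)"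
proof -
  obtain c where c: "0 < c" "\<And>z. dual_norm N z \<le> c * norm z"
    using dual_norm_le_norm by blast
  have "c-lipschitz_on S (dual_norm N)"
  proof (rule lipschitz_onI)
    fix x y
    have "dual_norm N x \<le> dual_norm N (x - y) + dual_norm N y"
      "dual_norm N y \<le> dual_norm N (y - x) + dual_norm N x"
      using dual_norm_triangle[of "x - y" y] dual_norm_triangle[of "y - x" x] by simp_all
    then show "dist (dual_norm N x) (dual_norm N y) \<le> c * dist x y"
      using c(2)[of "x - y"] dual_norm_minus[of "x - y"] by (simp add: dist_real_def dist_norm)
  qed (use c in simp)
  then show ?thesis
    by (rule lipschitz_on_continuous_on)
qed

lemma borel_measurable_dual_norm [measurable]: "dual_norm N \<in> borel_measurable borel"
  by (rule borel_measurable_continuous_onI) (rule continuous_on_dual_norm)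

lemma inner_le_half_squares: "x \<bullet> z \<le> (N x)\<^sup>2 / 2 + (dual_norm N z)\<^sup>2 / 2"
  using inner_le_dual_norm[of x z] sum_squares_bound[of "N x" "dual_norm N z"] by linarith

end

section \<open>Prox mapping and conjugate\<close>

text \<open>Serves to let \<open>u\<close> tend to 0 after moving a fraction \<open>u\<close> along
  a segment, where strong convexity or smoothness leaves a relative error of order
  \<open>u\<close>.\<close>

lemma ge_of_ge_linear:
  fixes a b :: real
  assumes "\<And>u. 0 < u \<Longrightarrow> u < 1 \<Longrightarrow> a - u * b \<le> c"
  shows "a \<le> c"
proof (rule tendsto_upperbound)
  show "((\<lambda>u. a - u * b) \<longlongrightarrow> a) (at_right 0)"
    by (auto intro!: tendsto_eq_intros)
  show "\<forall>\<^sub>F u in at_right 0. a - u * b \<le> c"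
    unfolding eventually_at_right_field using assms by (intro exI[of _ 1]) auto
qed simp

locale mirror_map = finite_dim_norm N for N :: "'a::euclidean_space \<Rightarrow> real" +
  fixes X :: "'a set" and w :: "'a \<Rightarrow> real" and dw :: "'a \<Rightarrow> 'a" and x0 :: 'a
  assumes closed_X: "closed X" and convex_X: "convex X" and x0_in: "x0 \<in> X"
    and gradient_w: "gradient_on UNIV w dw"
    and strongly_convex_w: "strongly_convex N 1 w"
begin

abbreviation V where "V \<equiv> bregman w dw x0"

lemma w_convex_comb:
  "0 < u \<Longrightarrow> u < 1 \<Longrightarrow>
    w ((1 - u) *\<^sub>R a + u *\<^sub>R b) \<le> (1 - u) * w a + u * w b - 1 / 2 * u * (1 - u) * (N (b - a))\<^sup>2"
  using strongly_convex_w N_minus_commute[of a b] unfolding strongly_convex_def by (metis atLeastAtMost_iff less_imp_le)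

text \<open>The inequality on the segment from \<open>a\<close> to \<open>b\<close> is divided by
  \<open>u\<close>; as \<open>u\<close> decreases to 0, the difference quotient of \<open>q\<close>
  tends to the directional derivative.\<close>

lemma w_lower_bound: "w a + dw a \<bullet> (b - a) + (N (b - a))\<^sup>2 / 2 \<le> w b"
proof -
  define q where "q u = w (a + u *\<^sub>R (b - a))" for u :: real
  have deriv_w: "(w has_derivative (\<lambda>h. dw a \<bullet> h)) (at a)" for a
    using gradient_w by (simp add: gradient_on_def)
  have "((\<lambda>u. a + u *\<^sub>R (b - a)) has_derivative (\<lambda>u. u *\<^sub>R (b - a))) (at 0)"
    by (auto intro!: derivative_eq_intros)
  moreover have "(w has_derivative (\<lambda>h. dw a \<bullet> h)) (at (a + 0 *\<^sub>R (b - a)))"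
    using deriv_w by simp
  ultimately have "(q has_derivative (\<lambda>u. dw a \<bullet> (u *\<^sub>R (b - a)))) (at 0)"
    unfolding q_def by (rule has_derivative_compose)
  then have "(q has_field_derivative (dw a \<bullet> (b - a))) (at 0)"
    by (simp add: has_field_derivative_def mult.commute[of _ "dw a \<bullet> (b - a)"])
  then have "((\<lambda>u. (q u - q 0) / u) \<longlongrightarrow> dw a \<bullet> (b - a)) (at_right 0)"
    by (auto simp: has_field_derivative_iff intro: tendsto_mono at_le)
  then have lim: "((\<lambda>u. (q u - q 0) / u + (1 - u) * ((N (b - a))\<^sup>2 / 2))
      \<longlongrightarrow> dw a \<bullet> (b - a) + (1 - 0) * ((N (b - a))\<^sup>2 / 2)) (at_right 0)"
    by (intro tendsto_intros)
  have "\<forall>\<^sub>F u in at_right 0. (q u - q 0) / u + (1 - u) * ((N (b - a))\<^sup>2 / 2) \<le> w b - w a"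
    unfolding eventually_at_right_field
  proof (intro exI[of _ 1] conjI allI impI)
    fix u :: real assume u: "0 < u" "u < 1"
    have "a + u *\<^sub>R (b - a) = (1 - u) *\<^sub>R a + u *\<^sub>R b"
      by (simp add: algebra_simps)
    then have "q u \<le> (1 - u) * w a + u * w b - 1 / 2 * u * (1 - u) * (N (b - a))\<^sup>2"
      using w_convex_comb[OF u] by (simp add: q_def)
    then have "q u - q 0 \<le> u * (w b - w a - (1 - u) * ((N (b - a))\<^sup>2 / 2))"
      by (simp add: q_def algebra_simps)
    then have "(q u - q 0) / u \<le> w b - w a - (1 - u) * ((N (b - a))\<^sup>2 / 2)"
      using u by (simp add: field_simps)
    then show "(q u - q 0) / u + (1 - u) * ((N (b - a))\<^sup>2 / 2) \<le> w b - w a" by simp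
  qed simp
  from tendsto_upperbound[OF lim this] show ?thesis by simp
qed

lemma V_lower_bound: "(N (v - u))\<^sup>2 / 2 \<le> V u v"
  using w_lower_bound[of "u - x0" "v - x0"] by (simp add: bregman_def)

lemma V_nonneg: "0 \<le> V u v"
  using V_lower_bound[of v u] zero_le_power2[of "N (v - u)"] by linarith

lemma continuous_on_w: "continuous_on S w"
  using gradient_w unfolding gradient_on_def
  by (meson UNIV_I continuous_on_subset has_derivative_continuous_on subset_UNIV)

abbreviation prox_obj where "prox_obj s v \<equiv> w (v - x0) - s \<bullet> v"

text \<open>Comparing the minimizer with points of the segment to \<open>v\<close> turns strong
  convexity into quadratic growth. Uniqueness of the minimizer, its Lipschitz dependence on
  \<open>s\<close> and the smoothness of the conjugate are all drawn from this bound.\<close>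

lemma prox_obj_growth:
  assumes p: "is_arg_min (prox_obj s) (\<lambda>v. v \<in> X) p" and v: "v \<in> X"
  shows "prox_obj s p + (N (v - p))\<^sup>2 / 2 \<le> prox_obj s v"
proof -
  have "(N (v - p))\<^sup>2 / 2 - u * ((N (v - p))\<^sup>2 / 2) \<le> prox_obj s v - prox_obj s p"
    if u: "0 < u" "u < 1" for u
  proof -
    let ?c = "(1 - u) *\<^sub>R p + u *\<^sub>R v"
    have "p \<in> X"
      using p by (simp add: is_arg_min_def)
    then have "?c \<in> X"
      using convexD[OF convex_X _ v, of p "1 - u" u] u by simp
    then have "prox_obj s p \<le> prox_obj s ?c"
      using p by (auto simp: is_arg_min_def not_less)
    moreover have "?c - x0 = (1 - u) *\<^sub>R (p - x0) + u *\<^sub>R (v - x0)"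
      by (simp add: algebra_simps)
    then have "w (?c - x0) \<le> (1 - u) * w (p - x0) + u * w (v - x0)
        - 1 / 2 * u * (1 - u) * (N (v - p))\<^sup>2"
      using w_convex_comb[OF u, of "p - x0" "v - x0"] by simp
    ultimately have "prox_obj s p \<le> (1 - u) * prox_obj s p + u * prox_obj s v
        - 1 / 2 * u * (1 - u) * (N (v - p))\<^sup>2"
      by (simp add: inner_add_right algebra_simps)
    then have "u * ((N (v - p))\<^sup>2 / 2 - u * ((N (v - p))\<^sup>2 / 2))
        \<le> u * (prox_obj s v - prox_obj s p)"
      by (simp add: algebra_simps diff_divide_distrib)
    then show ?thesis
      using u by simp
  qed
  from ge_of_ge_linear[OF this] show ?thesis by simp
qed

lemma prox_obj_coercive:
  obtains R where "0 \<le> R" and "\<And>v. R < norm (v - x0) \<Longrightarrow> prox_obj s x0 \<le> prox_obj s v"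
proof -
  obtain c where c: "0 < c" "\<And>x. norm x \<le> c * N x"
    using norm_le_N by blast
  define B where "B = norm (s - dw 0)"
  \<comment> \<open>Beyond this radius the quadratic term
    \<open>?n\<^sup>2 / (2 * c\<^sup>2)\<close>, which comes from strong convexity at 0, exceeds the
    linear term \<open>B * ?n\<close>.\<close>
  have "prox_obj s x0 \<le> prox_obj s v" if R: "2 * c\<^sup>2 * B < norm (v - x0)" for v
  proof -
    let ?n = "norm (v - x0)"
    have "?n\<^sup>2 \<le> (c * N (v - x0))\<^sup>2"
      by (rule power_mono[OF c(2)]) simp
    then have "?n\<^sup>2 / (2 * c\<^sup>2) \<le> (N (v - x0))\<^sup>2 / 2"
      using c(1) by (simp add: power_mult_distrib field_simps)
    moreover have "B * ?n \<le> ?n\<^sup>2 / (2 * c\<^sup>2)"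
    proof -
      have "2 * c\<^sup>2 * B * ?n \<le> ?n * ?n"
        using R by (intro mult_right_mono) auto
      then show ?thesis
        using c(1) by (simp add: field_simps power2_eq_square)
    qed
    moreover have "(s - dw 0) \<bullet> (v - x0) \<le> B * ?n"
      unfolding B_def by (rule norm_cauchy_schwarz)
    moreover have "w 0 + dw 0 \<bullet> (v - x0) + (N (v - x0))\<^sup>2 / 2 \<le> w (v - x0)"
      using w_lower_bound[of 0 "v - x0"] by simp
    ultimately show ?thesis
      by (simp add: inner_diff_left inner_diff_right)
  qed
  then show ?thesis
    using that[of "2 * c\<^sup>2 * B"] by (simp add: B_def)
qed

text \<open>Existence is needed at every dual vector, not only at those met by the algorithm: the
  noise estimate evaluates the mapping at partial sums within a batch. As \<open>X\<close> may be
  unbounded, coercivity first reduces the search to a ball.\<close>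

lemma ex_prox: "\<exists>p. is_arg_min (prox_obj s) (\<lambda>v. v \<in> X) p"
proof -
  obtain R where R: "0 \<le> R" "\<And>v. R < norm (v - x0) \<Longrightarrow> prox_obj s x0 \<le> prox_obj s v"
    using prox_obj_coercive by blast
  let ?K = "X \<inter> cball x0 R"
  have "compact ?K"
    using closed_X by (simp add: closed_Int_compact)
  moreover have "x0 \<in> ?K"
    using R(1) x0_in by simp
  moreover have "continuous_on ?K (prox_obj s)"
    by (intro continuous_intros continuous_on_compose2[OF continuous_on_w[of UNIV]]) auto
  ultimately obtain p where p: "p \<in> ?K" "\<And>v. v \<in> ?K \<Longrightarrow> prox_obj s p \<le> prox_obj s v"
    using continuous_attains_inf[of ?K "prox_obj s"] by blast
  have "prox_obj s p \<le> prox_obj s v" if "v \<in> X" for v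
  proof (cases "v \<in> cball x0 R")
    case False
    then have "prox_obj s x0 \<le> prox_obj s v"
      by (intro R(2)) (simp add: dist_norm norm_minus_commute)
    then show ?thesis
      using p(2)[OF \<open>x0 \<in> ?K\<close>] by linarith
  qed (use p that in auto)
  then show ?thesis
    using p(1) by (auto simp: is_arg_min_def not_less intro!: exI[of _ p])
qed

text \<open>The gradient of the conjugate \<open>conj_w\<close> below, as a mapping from dual
  vectors to \<open>X\<close>. The choice is harmless, because \<open>prox_eqI\<close> shows that
  the minimizer is unique.\<close>

definition prox where "prox s = (SOME p. is_arg_min (prox_obj s) (\<lambda>v. v \<in> X) p)"

lemma prox_arg_min: "is_arg_min (prox_obj s) (\<lambda>v. v \<in> X) (prox s)"
  unfolding prox_def by (rule someI_ex[OF ex_prox])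

lemma prox_in: "prox s \<in> X"
  using prox_arg_min[of s] by (simp add: is_arg_min_def)

lemma prox_eqI: "is_arg_min (prox_obj s) (\<lambda>v. v \<in> X) p \<Longrightarrow> prox s = p"
proof -
  assume p: "is_arg_min (prox_obj s) (\<lambda>v. v \<in> X) p"
  have "p \<in> X"
    using p by (simp add: is_arg_min_def)
  then have "(N (prox s - p))\<^sup>2 \<le> 0"
    using prox_obj_growth[OF p prox_in] prox_obj_growth[OF prox_arg_min, of p s]
      N_minus_commute[of p "prox s"] by (smt (verit) field_sum_of_halves)
  then show "prox s = p"
    by (simp add: N_eq_0_iff)
qed

text \<open>Nonnegativity of \<open>V u v\<close> says precisely that \<open>u\<close> minimizes
  this objective. Hence \<open>dw (u - x0)\<close> is a dual vector representing \<open>u\<close>,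
  from which a perturbed step can start.\<close>

lemma prox_dw: "u \<in> X \<Longrightarrow> prox (dw (u - x0)) = u"
proof (rule prox_eqI)
  assume "u \<in> X"
  moreover have "prox_obj (dw (u - x0)) u \<le> prox_obj (dw (u - x0)) v" for v
    using V_nonneg[of u v] by (simp add: bregman_def inner_diff_right)
  ultimately show "is_arg_min (prox_obj (dw (u - x0))) (\<lambda>v. v \<in> X) u"
    by (auto simp: is_arg_min_def not_less)
qed

text \<open>The growth bounds at the two minimizers, each tested with the other one, are added; the
  two halves of the square make up the constant 1.\<close>

lemma prox_lipschitz: "N (prox s - prox s') \<le> dual_norm N (s - s')"
proof -
  have "prox_obj s (prox s) + (N (prox s - prox s'))\<^sup>2 / 2 \<le> prox_obj s (prox s')"
    using prox_obj_growth[OF prox_arg_min prox_in, of s "s'"]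
    by (simp add: N_minus_commute[of "prox s'"])
  moreover have "prox_obj s' (prox s') + (N (prox s - prox s'))\<^sup>2 / 2 \<le> prox_obj s' (prox s)"
    by (rule prox_obj_growth[OF prox_arg_min prox_in])
  ultimately have "(N (prox s - prox s'))\<^sup>2 \<le> (prox s - prox s') \<bullet> (s - s')"
    by (simp add: inner_diff_left inner_diff_right inner_commute)
  also have "\<dots> \<le> N (prox s - prox s') * dual_norm N (s - s')"
    by (rule inner_le_dual_norm)
  finally show ?thesis
    using N_nonneg[of "prox s - prox s'"] dual_norm_nonneg[of "s - s'"]
    by (cases "N (prox s - prox s') = 0") (auto simp: power2_eq_square)
qed

lemma prox_norm_lipschitz: obtains C where "0 < C" and "\<And>s s'. norm (prox s - prox s') \<le> C * norm (s - s')"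
proof -
  obtain c where c: "0 < c" "\<And>x. norm x \<le> c * N x"
    using norm_le_N by blast
  obtain d where d: "0 < d" "\<And>z. dual_norm N z \<le> d * norm z"
    using dual_norm_le_norm by blast
  have "norm (prox s - prox s') \<le> (c * d) * norm (s - s')" for s s'
  proof -
    have "N (prox s - prox s') \<le> d * norm (s - s')"
      using prox_lipschitz d(2) order_trans by blast
    then have "c * N (prox s - prox s') \<le> c * (d * norm (s - s'))"
      using c(1) by simp
    then show ?thesis
      using c(2)[of "prox s - prox s'"] by (simp add: ac_simps)
  qed
  then show ?thesis
    using that[of "c * d"] c(1) d(1) by simp
qed

lemma borel_measurable_prox [measurable]: "prox \<in> borel_measurable borel"
proof (rule borel_measurable_continuous_onI)
  obtain C where "0 < C" "\<And>s s'. norm (prox s - prox s') \<le> C * norm (s - s')"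
    using prox_norm_lipschitz by blast
  then have "C-lipschitz_on UNIV prox"
    by (intro lipschitz_onI) (auto simp: dist_norm)
  then show "continuous_on UNIV prox"
    by (rule lipschitz_on_continuous_on)
qed

text \<open>The Fenchel conjugate of \<open>\<lambda>v. w (v - x0)\<close> on \<open>X\<close>,
  written through its maximizer instead of a supremum.\<close>

definition conj_w where "conj_w s = s \<bullet> prox s - w (prox s - x0)"

lemma conj_w_ge: "v \<in> X \<Longrightarrow> s \<bullet> v - w (v - x0) \<le> conj_w s"
  using prox_arg_min[of s] unfolding conj_w_def is_arg_min_def by force

text \<open>The growth bound at \<open>prox s\<close>, tested with \<open>prox (s + h)\<close>,
  leaves \<open>h \<bullet> (prox (s + h) - prox s)\<close> minus half a squared \<open>N\<close>;
  Young's inequality bounds this by the dual norm. Modulus 1 of strong convexity thus becomes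
  smoothness constant 1.\<close>

lemma conj_w_smooth: "conj_w (s + h) \<le> conj_w s + h \<bullet> prox s + (dual_norm N h)\<^sup>2 / 2"
proof -
  let ?v = "prox (s + h)"
  have "prox_obj s (prox s) + (N (?v - prox s))\<^sup>2 / 2 \<le> prox_obj s ?v"
    by (rule prox_obj_growth[OF prox_arg_min prox_in])
  moreover have "(?v - prox s) \<bullet> h \<le> (N (?v - prox s))\<^sup>2 / 2 + (dual_norm N h)\<^sup>2 / 2"
    by (rule inner_le_half_squares)
  ultimately show ?thesis
    unfolding conj_w_def by (simp add: inner_diff_left inner_add_left inner_commute[of h])
qed

text \<open>Each increment is paired with the prox point formed before it is added. This order is
  what later gives the inner products mean zero.\<close>

lemma conj_w_sum_smooth:
  fixes n :: nat
  shows "conj_w (s + (\<Sum>i=1..n. h i)) \<le> conj_w s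
     + (\<Sum>j=1..n. h j \<bullet> prox (s + (\<Sum>i=1..j - 1. h i)) + (dual_norm N (h j))\<^sup>2 / 2)"
proof (induction n)
  case (Suc n)
  have "conj_w (s + (\<Sum>i=1..Suc n. h i)) = conj_w ((s + (\<Sum>i=1..n. h i)) + h (Suc n))"
    by (simp add: add.assoc)
  also have "\<dots> \<le> conj_w (s + (\<Sum>i=1..n. h i)) + h (Suc n) \<bullet> prox (s + (\<Sum>i=1..n. h i))
      + (dual_norm N (h (Suc n)))\<^sup>2 / 2"
    by (rule conj_w_smooth)
  finally show ?case
    using Suc.IH by simp
qed simp

text \<open>The difference quotient of the objective from the minimizer towards \<open>v\<close> is
  nonnegative. Quadratic growth would be too weak for \<open>three_point\<close>: it yields only
  \<open>(N (v - z))\<^sup>2 / 2\<close> where the full \<open>V z v\<close> is needed.\<close>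

lemma arg_min_first_order:
  assumes z: "is_arg_min (prox_obj s) (\<lambda>v. v \<in> X) z" and v: "v \<in> X"
  shows "s \<bullet> (v - z) \<le> dw (z - x0) \<bullet> (v - z)"
proof -
  have zX: "z \<in> X" using z by (simp add: is_arg_min_def)
  define q where "q u = prox_obj s (z + u *\<^sub>R (v - z))" for u :: real
  have "((\<lambda>v. w (v - x0)) has_derivative (\<lambda>h. dw (z - x0) \<bullet> h)) (at z)"
  proof (rule has_derivative_compose[where f = "\<lambda>v. v - x0"])
    show "((\<lambda>v. v - x0) has_derivative (\<lambda>h. h)) (at z)"
      by (auto intro!: derivative_eq_intros)
    show "(w has_derivative (\<lambda>h. dw (z - x0) \<bullet> h)) (at (z - x0))"
      using gradient_w by (simp add: gradient_on_def)
  qed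
  then have "((\<lambda>v. prox_obj s v) has_derivative (\<lambda>h. dw (z - x0) \<bullet> h - s \<bullet> h)) (at z)"
    by (auto intro!: derivative_eq_intros)
  then have "((\<lambda>v. prox_obj s v) has_derivative (\<lambda>h. dw (z - x0) \<bullet> h - s \<bullet> h)) (at (z + 0 *\<^sub>R (v - z)))"
    by simp
  moreover have "((\<lambda>u. z + u *\<^sub>R (v - z)) has_derivative (\<lambda>u. u *\<^sub>R (v - z))) (at 0)"
    by (auto intro!: derivative_eq_intros)
  ultimately have "(q has_derivative (\<lambda>u. dw (z - x0) \<bullet> (u *\<^sub>R (v - z)) - s \<bullet> (u *\<^sub>R (v - z)))) (at 0)"
    unfolding q_def by (rule has_derivative_compose[rotated])
  then have "(q has_field_derivative (dw (z - x0) \<bullet> (v - z) - s \<bullet> (v - z))) (at 0)"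
    unfolding has_field_derivative_def by (rule has_derivative_eq_rhs) (auto simp: algebra_simps)
  then have lim: "((\<lambda>u. (q u - q 0) / u) \<longlongrightarrow> dw (z - x0) \<bullet> (v - z) - s \<bullet> (v - z)) (at_right 0)"
    by (auto simp: has_field_derivative_iff intro: tendsto_mono at_le)
  have "\<forall>\<^sub>F u in at_right 0. 0 \<le> (q u - q 0) / u"
    unfolding eventually_at_right_field
  proof (intro exI[of _ 1] conjI allI impI)
    fix u :: real assume u: "0 < u" "u < 1"
    have "z + u *\<^sub>R (v - z) = (1 - u) *\<^sub>R z + u *\<^sub>R v"
      by (simp add: algebra_simps)
    also have "\<dots> \<in> X"
      using convexD[OF convex_X zX v, of "1 - u" u] u by simp
    finally have "q 0 \<le> q u"
      using z unfolding q_def by (auto simp: is_arg_min_def not_less)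
    then show "0 \<le> (q u - q 0) / u"
      using u by simp
  qed simp
  from tendsto_lowerbound[OF lim this] show ?thesis by simp
qed

text \<open>Up to the positive factor \<open>e\<close> and the constant \<open>c\<close>, the
  objective of the algorithm is \<open>prox_obj\<close>. Uniqueness then turns the minimality
  condition into an equation, so that the iterates become explicit functions of the samples.\<close>

lemma prox_step_eq:
  assumes "0 < e" and z: "is_arg_min (\<lambda>v. G \<bullet> v + e * V u v) (\<lambda>v. v \<in> X) z"
  shows "z = prox (dw (u - x0) - (1 / e) *\<^sub>R G)"
proof -
  define c where "c = e * (dw (u - x0) \<bullet> u - w (u - x0))"
  have eq: "G \<bullet> v + e * V u v = e * prox_obj (dw (u - x0) - (1 / e) *\<^sub>R G) v + c" for v
    using assms(1) by (simp add: c_def bregman_def inner_diff_left inner_diff_right field_simps)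
  have "is_arg_min (prox_obj (dw (u - x0) - (1 / e) *\<^sub>R G)) (\<lambda>v. v \<in> X) z"
    using z assms(1) unfolding is_arg_min_def eq by simp
  then show ?thesis
    by (rule prox_eqI[symmetric])
qed

text \<open>The first-order condition at \<open>z\<close> is inserted into the identity \<open>V u v
  - V z v - V u z = (dw (z - x0) - dw (u - x0)) \<bullet> (v - z)\<close>.\<close>

lemma three_point:
  assumes "0 < e" and z: "z = prox (dw (u - x0) - (1 / e) *\<^sub>R G)" and "v \<in> X"
  shows "G \<bullet> (z - v) \<le> e * (V u v - V z v - V u z)"
proof -
  have "(dw (u - x0) - (1 / e) *\<^sub>R G) \<bullet> (v - z) \<le> dw (z - x0) \<bullet> (v - z)"
    using arg_min_first_order[OF prox_arg_min \<open>v \<in> X\<close>] z by blast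
  then have "dw (u - x0) \<bullet> (v - z) - dw (z - x0) \<bullet> (v - z) \<le> (G \<bullet> (v - z)) / e"
    by (simp add: inner_diff_left)
  then have "e * (dw (u - x0) \<bullet> (v - z) - dw (z - x0) \<bullet> (v - z)) \<le> G \<bullet> (v - z)"
    using assms(1) by (simp add: pos_le_divide_eq mult.commute)
  then show ?thesis
    by (simp add: bregman_def inner_diff_right algebra_simps)
qed

end

section \<open>A step along one trajectory\<close>

locale smooth_objective = mirror_map N X w dw x0
  for N :: "'a::euclidean_space \<Rightarrow> real" and X w dw x0 +
  fixes f :: "'a \<Rightarrow> real" and g :: "'a \<Rightarrow> 'a" and L :: real and xs :: 'a
  assumes L_nonneg: "0 \<le> L"
    and f_lower: "u \<in> X \<Longrightarrow> v \<in> X \<Longrightarrow> f u + g u \<bullet> (v - u) \<le> f v"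
    and f_upper: "u \<in> X \<Longrightarrow> v \<in> X \<Longrightarrow> f v \<le> f u + g u \<bullet> (v - u) + L / 2 * (N (v - u))\<^sup>2"
    and xs_in: "xs \<in> X" and xs_min: "v \<in> X \<Longrightarrow> f xs \<le> f v"
begin

text \<open>The Bregman divergence of \<open>f\<close> from \<open>xs\<close>, which is the
  state-dependent quantity of the variance hypothesis. With constraints, \<open>g xs\<close> need
  not vanish at a minimizer.\<close>

definition gap where "gap v = f v - f xs - g xs \<bullet> (v - xs)"

text \<open>\<open>xs\<close> is compared with a point at fraction \<open>u\<close> of the way to
  \<open>v\<close>. The smoothness inequality takes the place of a derivative, since its error is of
  order \<open>u\<^sup>2\<close>.\<close>

lemma optimality: "v \<in> X \<Longrightarrow> 0 \<le> g xs \<bullet> (v - xs)"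
proof -
  assume v: "v \<in> X"
  let ?B = "L / 2 * (N (v - xs))\<^sup>2"
  have "0 - u * ?B \<le> g xs \<bullet> (v - xs)" if u: "0 < u" "u < 1" for u
  proof -
    let ?c = "xs + u *\<^sub>R (v - xs)"
    have "?c = (1 - u) *\<^sub>R xs + u *\<^sub>R v"
      by (simp add: algebra_simps)
    then have "?c \<in> X"
      using convexD[OF convex_X xs_in v, of "1 - u" u] u by simp
    then have "0 \<le> u * (g xs \<bullet> (v - xs)) + L / 2 * (u\<^sup>2 * (N (v - xs))\<^sup>2)"
      using f_upper[OF xs_in, of ?c] xs_min[of ?c] u by (simp add: N_scale power_mult_distrib)
    then have "0 \<le> u * (g xs \<bullet> (v - xs) + u * ?B)"
      by (simp add: algebra_simps power2_eq_square)
    then show ?thesis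
      using u by (simp add: zero_le_mult_iff)
  qed
  from ge_of_ge_linear[OF this] show ?thesis by simp
qed

lemma gap_nonneg: "v \<in> X \<Longrightarrow> 0 \<le> gap v"
  using f_lower[OF xs_in, of v] by (simp add: gap_def)

lemma gap_le_value: "v \<in> X \<Longrightarrow> gap v \<le> f v - f xs"
  using optimality[of v] by (simp add: gap_def)

lemma gap_le_V: "v \<in> X \<Longrightarrow> gap v \<le> L * V v xs"
proof -
  assume "v \<in> X"
  then have "gap v \<le> L * ((N (xs - v))\<^sup>2 / 2)"
    using f_upper[OF xs_in, of v] by (simp add: gap_def N_minus_commute[of xs v])
  also have "\<dots> \<le> L * V v xs"
    by (rule mult_left_mono[OF V_lower_bound L_nonneg])
  finally show ?thesis .
qed

text \<open>The two points are estimated differently on purpose: the recursion carries the function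
  value at \<open>x\<close> but only the divergence at \<open>z\<close>.\<close>

lemma gap_convex_comb:
  assumes "convex_on X f" "a \<in> X" "b \<in> X" "0 \<le> \<beta>" "\<beta> \<le> 1"
  shows "gap ((1 - \<beta>) *\<^sub>R a + \<beta> *\<^sub>R b) \<le> (1 - \<beta>) * (f a - f xs) + \<beta> * (L * V b xs)"
proof -
  have "f ((1 - \<beta>) *\<^sub>R a + \<beta> *\<^sub>R b) \<le> (1 - \<beta>) * f a + \<beta> * f b"
    using convex_onD[OF assms(1) assms(4,5,2,3)] by simp
  then have "gap ((1 - \<beta>) *\<^sub>R a + \<beta> *\<^sub>R b) \<le> (1 - \<beta>) * gap a + \<beta> * gap b"
    by (simp add: gap_def inner_diff_right inner_add_right algebra_simps)
  also have "\<dots> \<le> (1 - \<beta>) * (f a - f xs) + \<beta> * (L * V b xs)"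
    using assms gap_le_value gap_le_V by (intro add_mono mult_left_mono) auto
  finally show ?thesis .
qed

text \<open>A quarter of the divergence \<open>V u z\<close> pays for the noise. Since this happens through the smooth
  conjugate of \<open>w\<close>, one sample at a time, the noise enters as \<open>b\<close> martingale increments plus \<open>b\<close>
  squared dual norms divided by \<open>b\<^sup>2\<close>. A direct estimate of the squared dual norm of the batch mean
  would not give the factor \<open>1 / b\<close> for a norm that is not Euclidean.\<close>

lemma prox_step_noise:
  fixes d :: "nat \<Rightarrow> 'a" and b :: nat and e u
  defines "K \<equiv> 4 / (real b * e)"
  defines "s \<equiv> \<lambda>j. dw (u - x0) + (\<Sum>i=1..j. - K *\<^sub>R d i)"
  assumes "0 < e" "1 \<le> b" "u \<in> X" "z \<in> X"
  shows "- (((1 / real b) *\<^sub>R (\<Sum>i=1..b. d i)) \<bullet> (z - u)) - e / 4 * V u z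
    \<le> e / 4 * (\<Sum>j=1..b. K\<^sup>2 / 2 * (dual_norm N (d j))\<^sup>2 - K * (d j \<bullet> (prox (s (j - 1)) - u)))"
proof -
  have K: "0 < K"
    using assms by (simp add: K_def)
  \<comment> \<open>With this value, \<open>V u z\<close> equals
    \<open>conj_w (dw (u - x0)) + w (z - x0) - dw (u - x0) \<bullet> z\<close>, the gap in Fenchel's
    inequality. A shift of the dual vector by the noise can therefore be charged to
    \<open>V u z\<close>.\<close>
  have conj_0: "conj_w (dw (u - x0)) = dw (u - x0) \<bullet> u - w (u - x0)"
    using \<open>u \<in> X\<close> by (simp add: conj_w_def prox_dw)
  have sb: "s b = dw (u - x0) - K *\<^sub>R (\<Sum>i=1..b. d i)"
    by (simp add: s_def scaleR_sum_right sum_negf)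
  have "s b \<bullet> z - w (z - x0) \<le> conj_w (s b)"
    by (rule conj_w_ge[OF \<open>z \<in> X\<close>])
  also have "\<dots> \<le> conj_w (dw (u - x0))
      + (\<Sum>j=1..b. - K *\<^sub>R d j \<bullet> prox (s (j - 1)) + (dual_norm N (- K *\<^sub>R d j))\<^sup>2 / 2)"
    unfolding s_def by (rule conj_w_sum_smooth)
  also have "(\<Sum>j=1..b. - K *\<^sub>R d j \<bullet> prox (s (j - 1)) + (dual_norm N (- K *\<^sub>R d j))\<^sup>2 / 2)
    = (\<Sum>j=1..b. (K\<^sup>2 / 2 * (dual_norm N (d j))\<^sup>2 - K * (d j \<bullet> (prox (s (j - 1)) - u))) - K * (d j \<bullet> u))"
    using K by (intro sum.cong refl)
      (simp add: dual_norm_minus dual_norm_scale power_mult_distrib inner_diff_right algebra_simps)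
  also have "\<dots> = (\<Sum>j=1..b. K\<^sup>2 / 2 * (dual_norm N (d j))\<^sup>2 - K * (d j \<bullet> (prox (s (j - 1)) - u)))
      - K * ((\<Sum>i=1..b. d i) \<bullet> u)"
    by (simp add: sum_subtractf inner_sum_left sum_distrib_left)
  finally have "- (K * ((\<Sum>i=1..b. d i) \<bullet> (z - u))) - V u z
    \<le> (\<Sum>j=1..b. K\<^sup>2 / 2 * (dual_norm N (d j))\<^sup>2 - K * (d j \<bullet> (prox (s (j - 1)) - u)))"
    by (simp add: conj_0 sb bregman_def inner_diff_left inner_diff_right algebra_simps)
  from mult_left_mono[OF this, of "e / 4"]
  have "- (e / 4 * K * ((\<Sum>i=1..b. d i) \<bullet> (z - u))) - e / 4 * V u z
    \<le> e / 4 * (\<Sum>j=1..b. K\<^sup>2 / 2 * (dual_norm N (d j))\<^sup>2 - K * (d j \<bullet> (prox (s (j - 1)) - u)))"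
    using \<open>0 < e\<close> by (simp add: right_diff_distrib mult.assoc)
  \<comment> \<open>The origin of \<open>K\<close>: after scaling by the available quarter
    \<open>e / 4\<close>, exactly the batch mean of the errors remains.\<close>
  moreover have "e / 4 * K = 1 / real b"
    using \<open>0 < e\<close> by (simp add: K_def)
  ultimately show ?thesis by (simp only: inner_scaleR_left)
qed

text \<open>The linear model of \<open>f\<close> at \<open>y\<close> splits along \<open>xp\<close>
  and \<open>z\<close>. Convexity bounds the first part by \<open>f xp\<close> and moves the second
  to \<open>xs\<close>, where it meets the three-point inequality. The errors \<open>d\<close> are
  arbitrary vectors; no probability enters.\<close>

lemma sagd_step:
  fixes d :: "nat \<Rightarrow> 'a" and b :: nat and e \<beta> u xp
  defines "K \<equiv> 4 / (real b * e)"
  defines "s \<equiv> \<lambda>j. dw (u - x0) + (\<Sum>i=1..j. - K *\<^sub>R d i)"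
  defines "y \<equiv> (1 - \<beta>) *\<^sub>R xp + \<beta> *\<^sub>R u"
  assumes e: "0 < e" and b: "1 \<le> b" and u: "u \<in> X" and xp: "xp \<in> X"
    and \<beta>: "0 \<le> \<beta>" "\<beta> \<le> 1" and L\<beta>: "L * \<beta> \<le> 3 / 4 * e"
    and z: "z = prox (dw (u - x0) - (1 / e) *\<^sub>R (g y + (1 / real b) *\<^sub>R (\<Sum>i=1..b. d i)))"
  shows "f ((1 - \<beta>) *\<^sub>R xp + \<beta> *\<^sub>R z) - f xs + \<beta> * e * V z xs
    \<le> (1 - \<beta>) * (f xp - f xs) + \<beta> * e * V u xs
      + \<beta> * e / 4 * (\<Sum>j=1..b. K\<^sup>2 / 2 * (dual_norm N (d j))\<^sup>2 - K * (d j \<bullet> (prox (s (j - 1)) - u)))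
      - \<beta> / real b * (\<Sum>j=1..b. d j \<bullet> (u - xs))"
proof -
  define x where "x = (1 - \<beta>) *\<^sub>R xp + \<beta> *\<^sub>R z"
  define D where "D = (1 / real b) *\<^sub>R (\<Sum>i=1..b. d i)"
  define S where "S = (\<Sum>j=1..b. K\<^sup>2 / 2 * (dual_norm N (d j))\<^sup>2 - K * (d j \<bullet> (prox (s (j - 1)) - u)))"
  have zX: "z \<in> X"
    using z prox_in by simp
  have yX: "y \<in> X" and xX: "x \<in> X"
    unfolding y_def x_def using convexD[OF convex_X xp _, of _ "1 - \<beta>" \<beta>] \<beta> u zX by simp_all
  have "x - y = \<beta> *\<^sub>R (z - u)"
    by (simp add: x_def y_def algebra_simps)
  then have Nxy: "(N (x - y))\<^sup>2 = \<beta>\<^sup>2 * (N (z - u))\<^sup>2"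
    by (simp add: N_scale power_mult_distrib)
  have "g y \<bullet> (x - y) = (1 - \<beta>) * (g y \<bullet> (xp - y)) + \<beta> * (g y \<bullet> (z - y))"
    by (simp add: x_def inner_add_right inner_diff_right algebra_simps)
  then have "f y + g y \<bullet> (x - y)
      = (1 - \<beta>) * (f y + g y \<bullet> (xp - y)) + \<beta> * (f y + g y \<bullet> (z - y))"
    by (simp add: algebra_simps)
  also have "\<dots> \<le> (1 - \<beta>) * f xp + \<beta> * (f xs + g y \<bullet> (z - xs))"
  proof (rule add_mono[OF mult_left_mono mult_left_mono])
    show "f y + g y \<bullet> (xp - y) \<le> f xp"
      by (rule f_lower[OF yX xp])
    show "f y + g y \<bullet> (z - y) \<le> f xs + g y \<bullet> (z - xs)"
      using f_lower[OF yX xs_in] by (simp add: inner_diff_right)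
  qed (use \<beta> in auto)
  finally have 1: "f x - f xs \<le> (1 - \<beta>) * (f xp - f xs) + \<beta> * (g y \<bullet> (z - xs))
      + L / 2 * (\<beta>\<^sup>2 * (N (z - u))\<^sup>2)"
    using f_upper[OF yX xX] by (simp add: Nxy algebra_simps)
  have "L / 2 * (\<beta>\<^sup>2 * (N (z - u))\<^sup>2) = \<beta> * ((L * \<beta>) * ((N (z - u))\<^sup>2 / 2))"
    by (simp add: power2_eq_square)
  also have "\<dots> \<le> \<beta> * (3 / 4 * e * V u z)"
    using \<beta> e V_lower_bound[of z u] L\<beta>
    by (intro mult_left_mono[OF mult_mono]) auto
  finally have 2: "L / 2 * (\<beta>\<^sup>2 * (N (z - u))\<^sup>2) \<le> \<beta> * (3 / 4 * e * V u z)" .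
  have 3: "(g y + D) \<bullet> (z - xs) \<le> e * (V u xs - V z xs - V u z)"
    using three_point[OF e _ xs_in] z unfolding D_def by blast
  have 4: "- (D \<bullet> (z - u)) - e / 4 * V u z \<le> e / 4 * S"
    unfolding D_def S_def s_def K_def by (rule prox_step_noise[OF e b u zX])
  \<comment> \<open>The error term is split at \<open>u\<close>. In
    \<open>D \<bullet> (z - u)\<close> the new point depends on the same samples, so this part is
    charged to the last quarter of \<open>V u z\<close>; \<open>D \<bullet> (u - xs)\<close> pairs
    fresh errors with old data and will average to zero.\<close>
  have "g y \<bullet> (z - xs) + 3 / 4 * e * V u z
    \<le> e * V u xs - e * V z xs + e / 4 * S - D \<bullet> (u - xs)"
    using 3 4 by (simp add: inner_add_left inner_diff_right algebra_simps)
  from mult_left_mono[OF this \<beta>(1)] 1 2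
  have "f x - f xs + \<beta> * e * V z xs
    \<le> (1 - \<beta>) * (f xp - f xs) + \<beta> * e * V u xs + \<beta> * e / 4 * S - \<beta> * (D \<bullet> (u - xs))"
    by (simp add: algebra_simps)
  then show ?thesis
    by (simp add: D_def S_def x_def inner_sum_left)
qed

end

section \<open>The scalar recursion\<close>

text \<open>With \<open>A t = t (t + 1) (t + 2) d t\<close> the invariant is \<open>A t + 3 \<eta> t v t \<le> 3 \<eta> t U t\<close>. The noise
  proportional to \<open>d\<close> multiplies \<open>A (t - 1)\<close> by at most \<open>1 + 1 / (t - 1)\<close>, which the growth of the
  weight from \<open>t - 1\<close> to \<open>t\<close> absorbs; only the other two noise terms make \<open>U\<close> grow.\<close>

lemma sagd_recursion:
  fixes d v :: "nat \<Rightarrow> real" and \<eta> D L \<L> \<sigma> r a c :: real and k :: nat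
  defines "U \<equiv> \<lambda>t. D\<^sup>2 * (1 + a * ((real t * (real t + 1) + 2 * real t / 3) / (real k + 1)\<^sup>2)
      + c * ((real t + 2) ^ 3 / (real k + 2) ^ 3))"
  assumes nonneg: "\<And>t. 0 \<le> d t" "\<And>t. 0 \<le> v t" and v0: "v 0 \<le> D\<^sup>2"
    and pos: "0 < \<eta>" "0 < r" "0 \<le> \<L>" and a: "0 \<le> a" "a \<le> 1" and c: "0 \<le> c" "c \<le> 1"
    and \<eta>1: "6 * (real k - 1) * \<L> / r \<le> \<eta>"
    and \<eta>2: "9 * (real k + 1)\<^sup>2 * L * \<L> / r \<le> a * \<eta>\<^sup>2"
    and \<eta>3: "\<sigma>\<^sup>2 * (2 * (real k + 2) ^ 3 / (3 * r)) \<le> c * D\<^sup>2 * \<eta>\<^sup>2"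
    and step: "\<And>n \<beta> e. n < k \<Longrightarrow> \<beta> = 3 / (real n + 3) \<Longrightarrow> e = \<eta> / (real n + 2) \<Longrightarrow>
      d (Suc n) + \<beta> * e * v (Suc n) \<le> (1 - \<beta>) * d n + \<beta> * e * v n
        + 2 * \<beta> / (r * e) * (\<L> * ((1 - \<beta>) * d n + \<beta> * (L * v n)) + \<sigma>\<^sup>2)"
  shows "t \<le> k \<Longrightarrow> real t * (real t + 1) * (real t + 2) * d t \<le> 3 * \<eta> * real t * (U t - v t)
      \<and> v t \<le> U t \<and> U t \<le> D\<^sup>2 * (1 + a + c)"
proof (induction t)
  case 0
  \<comment> \<open>The cube in \<open>U\<close> is \<open>(t + 2) ^ 3\<close>, so
    \<open>U 0\<close> exceeds \<open>D\<^sup>2\<close> by this term. The weighted estimate is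
    trivial at \<open>t = 0\<close>.\<close>
  have "0 \<le> D\<^sup>2 * (c * (8 / (real k + 2) ^ 3))"
    using c by simp
  moreover have "D\<^sup>2 * (c * (8 / (real k + 2) ^ 3)) \<le> D\<^sup>2 * (c * 1)"
  proof (intro mult_left_mono)
    have "2 ^ 3 \<le> (real k + 2) ^ 3"
      by (rule power_mono) auto
    then show "8 / (real k + 2) ^ 3 \<le> 1"
      by simp
  qed (use c in auto)
  moreover have "0 \<le> D\<^sup>2 * a"
    using a by simp
  ultimately show ?case
    using v0 by (simp add: U_def algebra_simps)
next
  case (Suc n)
  define T where "T = real n + 1"
  have T: "1 \<le> T" "real (Suc n) = T" "real n = T - 1"
    by (simp_all add: T_def)
  have Tk: "T \<le> real k"
    using Suc.prems by (simp add: T_def)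
  define A where "A = real n * (real n + 1) * (real n + 2) * d n"
  define B where "B = T * (T + 1) * (T + 2) * d (Suc n)"
  have IH: "A \<le> 3 * \<eta> * (T - 1) * (U n - v n)" "v n \<le> U n" "U n \<le> D\<^sup>2 * (1 + a + c)"
    using Suc by (simp_all add: A_def T)
  define \<beta> where "\<beta> = 3 / (T + 2)"
  define e where "e = \<eta> / (T + 1)"
  have nz: "T + 2 \<noteq> 0" "T + 1 \<noteq> 0" using T(1) by auto
  \<comment> \<open>Reason for the weight \<open>T * (T + 1) * (T + 2)\<close>: the factor
    \<open>1 - \<beta>\<close> turns it into the weight of the preceding step, and
    \<open>\<beta> * e\<close> turns it into \<open>3 * \<eta> * T\<close>.\<close>
  have w1: "(T + 2) * (1 - \<beta>) = T - 1" "(T + 2) * \<beta> = 3" "(T + 1) * e = \<eta>"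
    using nz by (simp_all add: \<beta>_def e_def field_simps)
  have w4: "T * (T + 1) * (T + 2) * (\<beta> * e) = 3 * \<eta> * T"
    using w1 by (metis (no_types, opaque_lifting) mult.assoc mult.commute)
  have "d (Suc n) + \<beta> * e * v (Suc n) \<le> (1 - \<beta>) * d n + \<beta> * e * v n
        + 2 * \<beta> / (r * e) * (\<L> * ((1 - \<beta>) * d n + \<beta> * (L * v n)) + \<sigma>\<^sup>2)"
    using Suc.prems by (intro step) (simp_all add: \<beta>_def e_def T_def add.commute)
  from mult_left_mono[OF this, of "T * (T + 1) * (T + 2)"]
  have "T * (T + 1) * (T + 2) * (d (Suc n) + \<beta> * e * v (Suc n))
    \<le> T * (T + 1) * (T + 2) * ((1 - \<beta>) * d n + \<beta> * e * v n
        + 2 * \<beta> / (r * e) * (\<L> * ((1 - \<beta>) * d n + \<beta> * (L * v n)) + \<sigma>\<^sup>2))"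
    using T(1) by simp
  also have "T * (T + 1) * (T + 2) * (d (Suc n) + \<beta> * e * v (Suc n)) = B + 3 * \<eta> * T * v (Suc n)"
    unfolding B_def w4[symmetric] by (simp add: distrib_left mult.assoc)
  also have "T * (T + 1) * (T + 2) * ((1 - \<beta>) * d n + \<beta> * e * v n
        + 2 * \<beta> / (r * e) * (\<L> * ((1 - \<beta>) * d n + \<beta> * (L * v n)) + \<sigma>\<^sup>2))
    = A + 3 * \<eta> * T * v n + 6 * \<L> * (T + 1) / ((T + 2) * r * \<eta>) * A
      + 6 * T * (T + 1)\<^sup>2 / (r * \<eta>) * (3 / (T + 2) * (L * \<L>) * v n)
      + 6 * T * (T + 1)\<^sup>2 / (r * \<eta>) * \<sigma>\<^sup>2"
  proof -
    have A_eq: "A = T * (T + 1) * ((T + 2) * (1 - \<beta>)) * d n"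
      by (simp add: A_def w1 T)
    have w2: "T * (T + 1) * (T + 2) * (2 * \<beta> / (r * e)) = 6 * T * (T + 1)\<^sup>2 / (r * \<eta>)"
    proof -
      have "T * (T + 1) * (T + 2) * (2 * \<beta> / (r * e)) = T * (T + 1) * (2 * ((T + 2) * \<beta>)) / (r * e)"
        by simp
      also have "\<dots> = 6 * (T * (T + 1)) / (r * e)"
        by (simp only: w1) simp
      also have "\<dots> = 6 * T * (T + 1)\<^sup>2 / (r * \<eta>)"
        using nz pos by (simp add: e_def power2_eq_square)
      finally show ?thesis .
    qed
    have w3: "6 * T * (T + 1)\<^sup>2 / (r * \<eta>) * (\<L> * ((1 - \<beta>) * d n)) = 6 * \<L> * (T + 1) / ((T + 2) * r * \<eta>) * A"
    proof -
      have "6 * T * q\<^sup>2 / (r * \<eta>) * (\<L> * (b * x)) = 6 * \<L> * q / (p * r * \<eta>) * (T * q * (p * b) * x)"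
        if "p \<noteq> 0" for p q b x
        using that by (simp add: power2_eq_square)
      from this[OF nz(1)] show ?thesis
        unfolding A_eq .
    qed
    have "T * (T + 1) * (T + 2) * ((1 - \<beta>) * d n + \<beta> * e * v n
        + 2 * \<beta> / (r * e) * (\<L> * ((1 - \<beta>) * d n + \<beta> * (L * v n)) + \<sigma>\<^sup>2))
      = A + T * (T + 1) * (T + 2) * (\<beta> * e) * v n
        + T * (T + 1) * (T + 2) * (2 * \<beta> / (r * e)) * (\<L> * ((1 - \<beta>) * d n))
        + T * (T + 1) * (T + 2) * (2 * \<beta> / (r * e)) * (\<beta> * (L * \<L>) * v n)
        + T * (T + 1) * (T + 2) * (2 * \<beta> / (r * e)) * \<sigma>\<^sup>2"
      unfolding A_eq by (simp only: distrib_left distrib_right mult.assoc mult.commute mult.left_commute add.assoc)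
    also have "\<dots> = A + 3 * \<eta> * T * v n + 6 * \<L> * (T + 1) / ((T + 2) * r * \<eta>) * A
      + 6 * T * (T + 1)\<^sup>2 / (r * \<eta>) * (3 / (T + 2) * (L * \<L>) * v n)
      + 6 * T * (T + 1)\<^sup>2 / (r * \<eta>) * \<sigma>\<^sup>2"
      unfolding w2 w3 w4 by (simp add: \<beta>_def)
    finally show ?thesis .
  qed
  finally have main: "B + 3 * \<eta> * T * v (Suc n)
    \<le> A + 3 * \<eta> * T * v n + 6 * \<L> * (T + 1) / ((T + 2) * r * \<eta>) * A
      + 6 * T * (T + 1)\<^sup>2 / (r * \<eta>) * (3 / (T + 2) * (L * \<L>) * v n)
      + 6 * T * (T + 1)\<^sup>2 / (r * \<eta>) * \<sigma>\<^sup>2" .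
  have growth: "A + 6 * \<L> * (T + 1) / ((T + 2) * r * \<eta>) * A \<le> 3 * \<eta> * T * (U n - v n)"
  proof -
    define \<alpha> where "\<alpha> = 6 * \<L> * (T + 1) / ((T + 2) * r * \<eta>)"
    \<comment> \<open>The bound on \<open>A\<close> carries the factor \<open>T - 1\<close>, and
      \<open>T - 1 \<le> real k - 1\<close>; hence the factor \<open>k - 1\<close> in the second
      term of \<open>\<eta>\<close>.\<close>
    have "(T - 1) * \<alpha> \<le> 1"
    proof -
      have "(T - 1) * (6 * \<L>) \<le> (real k - 1) * (6 * \<L>)"
        using Tk pos by (intro mult_right_mono) auto
      also have "\<dots> \<le> r * \<eta>"
        using \<eta>1 pos by (simp add: field_simps)
      finally have "(T - 1) * (6 * \<L>) * (T + 1) \<le> r * \<eta> * (T + 2)"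
        by (rule mult_mono) (use T(1) pos in auto)
      then have "(T - 1) * (6 * \<L>) * (T + 1) / (r * \<eta> * (T + 2)) \<le> 1"
        using T(1) pos by (intro divide_le_eq_1_pos[THEN iffD2]) auto
      then show ?thesis
        by (simp only: \<alpha>_def times_divide_eq_right mult_ac)
    qed
    moreover have "0 \<le> \<alpha>"
      using T(1) pos by (simp add: \<alpha>_def)
    moreover have "0 \<le> U n - v n"
      using IH by simp
    ultimately have "(1 + \<alpha>) * A \<le> (1 + \<alpha>) * (3 * \<eta> * (T - 1) * (U n - v n))"
      using IH by (intro mult_left_mono) auto
    also have "\<dots> = 3 * \<eta> * (U n - v n) * (T - 1 + (T - 1) * \<alpha>)"
      by (simp add: algebra_simps)
    also have "\<dots> \<le> 3 * \<eta> * (U n - v n) * T"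
      using \<open>(T - 1) * \<alpha> \<le> 1\<close> pos \<open>0 \<le> U n - v n\<close> by (intro mult_left_mono) auto
    finally show ?thesis
      unfolding \<alpha>_def by (simp add: algebra_simps)
  qed
  \<comment> \<open>Bootstrap: the induction hypothesis bounds the divergence that occurs in the
    current noise.\<close>
  have "v n \<le> D\<^sup>2 * (1 + a + c)"
    using IH by linarith
  also have "\<dots> \<le> D\<^sup>2 * 3"
    using a c by (intro mult_left_mono) auto
  finally have v3: "v n \<le> 3 * D\<^sup>2" by simp
  have noise1: "6 * T * (T + 1)\<^sup>2 / (r * \<eta>) * (3 / (T + 2) * (L * \<L>) * v n)
    \<le> 3 * \<eta> * T * (D\<^sup>2 * (a * ((2 * T + 2 / 3) / (real k + 1)\<^sup>2)))"
  proof -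
    have "L * \<L> / r \<le> a * \<eta>\<^sup>2 / (9 * (real k + 1)\<^sup>2)"
    proof -
      have "(9 * (real k + 1)\<^sup>2) * (L * \<L> / r) \<le> a * \<eta>\<^sup>2"
        using \<eta>2 by (simp add: mult.assoc)
      then show ?thesis
        by (simp add: pos_le_divide_eq mult.commute)
    qed
    then have "L * \<L> / r * v n \<le> a * \<eta>\<^sup>2 / (9 * (real k + 1)\<^sup>2) * (3 * D\<^sup>2)"
      using v3 nonneg a by (intro mult_mono) auto
    then have "(18 * T / \<eta>) * ((T + 1)\<^sup>2 / (T + 2)) * (L * \<L> / r * v n)
      \<le> (18 * T / \<eta>) * ((T + 1)\<^sup>2 / (T + 2)) * (a * \<eta>\<^sup>2 / (9 * (real k + 1)\<^sup>2) * (3 * D\<^sup>2))"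
      using T(1) pos by (intro mult_left_mono) auto
    also have "\<dots> \<le> (18 * T / \<eta>) * (T + (1 / 3)) * (a * \<eta>\<^sup>2 / (9 * (real k + 1)\<^sup>2) * (3 * D\<^sup>2))"
    proof (rule mult_right_mono)
      \<comment> \<open>Equality at \<open>T = 1\<close> makes \<open>1 / 3\<close> the least
        possible constant. It is the source of \<open>2 * real t / 3\<close> in \<open>U\<close>,
        which adds \<open>2 / 3\<close> to the increment \<open>2 * T\<close> of
        \<open>t * (t + 1)\<close>.\<close>
      have "(T + 1)\<^sup>2 \<le> (T + 1 / 3) * (T + 2)"
        using T(1) by (simp add: power2_eq_square algebra_simps)
      then have "(T + 1)\<^sup>2 / (T + 2) \<le> T + 1 / 3"
        using T(1) by (simp add: divide_le_eq)
      then show "18 * T / \<eta> * ((T + 1)\<^sup>2 / (T + 2)) \<le> 18 * T / \<eta> * (T + 1 / 3)"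
        using T(1) pos by (intro mult_left_mono) auto
    qed (use a in auto)
    finally have "(18 * T / \<eta>) * ((T + 1)\<^sup>2 / (T + 2)) * (L * \<L> / r * v n)
      \<le> (18 * T / \<eta>) * (T + (1 / 3)) * (a * \<eta>\<^sup>2 / (9 * (real k + 1)\<^sup>2) * (3 * D\<^sup>2))" .
    moreover have "(18 * T / \<eta>) * ((T + 1)\<^sup>2 / (T + 2)) * (L * \<L> / r * v n)
        = 6 * T * (T + 1)\<^sup>2 / (r * \<eta>) * (3 / (T + 2) * (L * \<L>) * v n)"
      by (simp add: mult_ac)
    moreover have "(18 * T / \<eta>) * (T + (1 / 3)) * (a * \<eta>\<^sup>2 / (9 * (real k + 1)\<^sup>2) * (3 * D\<^sup>2))
        = 3 * \<eta> * T * (D\<^sup>2 * (a * ((2 * T + 2 / 3) / (real k + 1)\<^sup>2)))"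
    proof -
      have "(18 * T / \<eta>) * (T + (1 / 3)) * (a * \<eta>\<^sup>2 / (9 * q) * (3 * D\<^sup>2))
          = 3 * \<eta> * T * (D\<^sup>2 * (a * ((2 * T + 2 / 3) / q)))" if "0 < q" for q
        using pos that by (simp add: field_simps power2_eq_square)
      from this[of "(real k + 1)\<^sup>2"] show ?thesis
        by (simp only: zero_less_power add_nonneg_pos of_nat_0_le_iff zero_less_one)
    qed
    ultimately show ?thesis by simp
  qed
  have noise2: "6 * T * (T + 1)\<^sup>2 / (r * \<eta>) * \<sigma>\<^sup>2
    \<le> 3 * \<eta> * T * (D\<^sup>2 * (c * (((T + 2) ^ 3 - (T + 1) ^ 3) / (real k + 2) ^ 3)))"
  proof -
    have "\<sigma>\<^sup>2 / r \<le> (c * D\<^sup>2 * \<eta>\<^sup>2) * (3 / (2 * (real k + 2) ^ 3))"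
    proof -
      have "(2 * (real k + 2) ^ 3 / 3) * (\<sigma>\<^sup>2 / r) \<le> c * D\<^sup>2 * \<eta>\<^sup>2"
        using \<eta>3 by (simp add: mult.commute)
      then show ?thesis
        by (simp add: field_simps)
    qed
    then have "(6 * T * (T + 1)\<^sup>2 / \<eta>) * (\<sigma>\<^sup>2 / r)
      \<le> (6 * T * (T + 1)\<^sup>2 / \<eta>) * ((c * D\<^sup>2 * \<eta>\<^sup>2) * (3 / (2 * (real k + 2) ^ 3)))"
      using T(1) pos by (intro mult_left_mono) auto
    also have "\<dots> = 3 * \<eta> * T * (D\<^sup>2 * (c * (3 * (T + 1)\<^sup>2 / (real k + 2) ^ 3)))"
      using pos by (simp add: field_simps power2_eq_square)
    \<comment> \<open>A difference of consecutive cubes dominates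
      \<open>3 * (T + 1)\<^sup>2\<close>, so this noise telescopes into the cube in
      \<open>U\<close>. The factor 6 of the noise against \<open>3 * 3\<close> here gives the
      \<open>2 / 3\<close> under the root in \<open>\<eta>\<close>.\<close>
    also have "\<dots> \<le> 3 * \<eta> * T * (D\<^sup>2 * (c * (((T + 2) ^ 3 - (T + 1) ^ 3) / (real k + 2) ^ 3)))"
      using T(1) pos c
      by (intro mult_left_mono divide_right_mono) (auto simp: power2_eq_square power3_eq_cube algebra_simps)
    finally show ?thesis by (simp add: mult.commute[of r])
  qed
  have U_Suc: "U (Suc n) = U n + D\<^sup>2 * (a * ((2 * T + 2 / 3) / (real k + 1)\<^sup>2))
      + D\<^sup>2 * (c * (((T + 2) ^ 3 - (T + 1) ^ 3) / (real k + 2) ^ 3))"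
  proof -
    have "real (Suc n) * (real (Suc n) + 1) + 2 * real (Suc n) / 3
        = (real n * (real n + 1) + 2 * real n / 3) + (2 * T + 2 / 3)"
      by (simp add: T_def field_simps)
    moreover have "(real (Suc n) + 2) ^ 3 = (real n + 2) ^ 3 + ((T + 2) ^ 3 - (T + 1) ^ 3)"
      by (simp add: T_def add.commute)
    ultimately show ?thesis
      unfolding U_def by (simp add: add_divide_distrib distrib_left)
  qed
  have le: "B + 3 * \<eta> * T * v (Suc n) \<le> 3 * \<eta> * T * U (Suc n)"
    using main growth noise1 noise2 unfolding U_Suc by (simp add: algebra_simps)
  moreover have "0 \<le> B"
    using nonneg T(1) by (simp add: B_def)
  ultimately have "3 * \<eta> * T * v (Suc n) \<le> 3 * \<eta> * T * U (Suc n)"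
    by linarith
  then have "v (Suc n) \<le> U (Suc n)"
    using pos T(1) by simp
  moreover have "U (Suc n) \<le> D\<^sup>2 * (1 + a * 1 + c * 1)"
    unfolding U_def T(2)
  proof (intro mult_left_mono add_mono order_refl)
    have "T * (T + 1) + 2 * T / 3 \<le> (T + 1)\<^sup>2"
      using T(1) by (simp add: power2_eq_square algebra_simps)
    also have "\<dots> \<le> (real k + 1)\<^sup>2"
      using T(1) Tk by (intro power_mono) auto
    finally show "(T * (T + 1) + 2 * T / 3) / (real k + 1)\<^sup>2 \<le> 1"
      by (simp add: divide_le_eq)
    have "(T + 2) ^ 3 \<le> (real k + 2) ^ 3"
      using T(1) Tk by (intro power_mono) auto
    then show "(T + 2) ^ 3 / (real k + 2) ^ 3 \<le> 1"
      by (simp add: divide_le_eq)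
  qed (use a c in auto)
  ultimately show ?case
    using le unfolding T(2) by (simp add: B_def right_diff_distrib)
qed

text \<open>Since \<open>\<eta> * (h / \<eta>)\<^sup>2 \<le> h\<close> whenever
  \<open>0 \<le> h \<le> \<eta>\<close>, and \<open>\<eta>\<close> is at most the sum of the four
  terms, \<open>h1\<close> and \<open>h2\<close> enter once and \<open>h3\<close> and
  \<open>h4\<close> twice. The rest is rounding to the stated form.\<close>

lemma sagd_final_rate:
  fixes D L \<L> \<sigma> \<eta> :: real and k m :: nat
  defines "h1 \<equiv> 4 * L" and "h2 \<equiv> 6 * (real k - 1) * \<L> / real m"
    and "h3 \<equiv> sqrt (9 * (real k + 1)\<^sup>2 * L * \<L> / real m)"
    and "h4 \<equiv> \<sigma> / D * sqrt (2 * (real k + 2) ^ 3 / (3 * real m))"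
  assumes k: "2 \<le> k" and m: "1 \<le> m" and nonneg: "0 \<le> L" "0 \<le> \<L>" "0 \<le> \<sigma>" and D: "0 < D"
    and \<eta>: "\<eta> = Max {h1, h2, h3, h4}" and \<eta>_pos: "0 < \<eta>"
  shows "3 * \<eta> * (D\<^sup>2 * (1 + (h3 / \<eta>)\<^sup>2 + (h4 / \<eta>)\<^sup>2)) / ((real k + 1) * (real k + 2))
    \<le> 12 * L * D\<^sup>2 / ((real k + 1) * (real k + 2))
      + 18 * \<L> * D\<^sup>2 / ((real k + 2) * real m)
      + 18 * D\<^sup>2 * sqrt (L * \<L>) / ((real k + 1) * sqrt (real m))
      + 4 * \<sigma> * D * sqrt 2 / sqrt ((real k + 1) * real m)"
proof -
  have h: "0 \<le> h1" "0 \<le> h2" "0 \<le> h3" "0 \<le> h4"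
    using nonneg D k by (simp_all add: h1_def h2_def h3_def h4_def)
  have h_le: "h3 \<le> \<eta>" "h4 \<le> \<eta>"
    unfolding \<eta> by (auto intro: Max_ge)
  have "\<eta> \<in> {h1, h2, h3, h4}"
    unfolding \<eta> by (rule Max_in) auto
  then have "\<eta> \<le> h1 + h2 + h3 + h4"
    using h by auto
  have sq: "\<eta> * (x / \<eta>)\<^sup>2 \<le> x" if "0 \<le> x" "x \<le> \<eta>" for x
  proof -
    have "x * x \<le> x * \<eta>"
      using that by (intro mult_left_mono) auto
    then show ?thesis
      using \<eta>_pos by (simp add: power2_eq_square field_simps)
  qed
  have "\<eta> * (1 + (h3 / \<eta>)\<^sup>2 + (h4 / \<eta>)\<^sup>2) \<le> h1 + h2 + 2 * h3 + 2 * h4"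
    using \<open>\<eta> \<le> _\<close> sq[OF h(3) h_le(1)] sq[OF h(4) h_le(2)] by (simp add: algebra_simps)
  then have "3 * D\<^sup>2 * (\<eta> * (1 + (h3 / \<eta>)\<^sup>2 + (h4 / \<eta>)\<^sup>2)) / ((real k + 1) * (real k + 2))
    \<le> 3 * D\<^sup>2 * (h1 + h2 + 2 * h3 + 2 * h4) / ((real k + 1) * (real k + 2))"
    by (intro divide_right_mono mult_left_mono) auto
  also have "\<dots> = 3 * D\<^sup>2 * h1 / ((real k + 1) * (real k + 2)) + 3 * D\<^sup>2 * h2 / ((real k + 1) * (real k + 2))
      + 6 * D\<^sup>2 * h3 / ((real k + 1) * (real k + 2)) + 6 * D\<^sup>2 * h4 / ((real k + 1) * (real k + 2))"
    by (simp add: distrib_left add_divide_distrib)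
  also have "\<dots> \<le> 12 * L * D\<^sup>2 / ((real k + 1) * (real k + 2))
      + 18 * \<L> * D\<^sup>2 / ((real k + 2) * real m)
      + 18 * D\<^sup>2 * sqrt (L * \<L>) / ((real k + 1) * sqrt (real m))
      + 4 * \<sigma> * D * sqrt 2 / sqrt ((real k + 1) * real m)"
  proof (intro add_mono)
    show "3 * D\<^sup>2 * h1 / ((real k + 1) * (real k + 2)) \<le> 12 * L * D\<^sup>2 / ((real k + 1) * (real k + 2))"
      by (simp add: h1_def mult_ac)
    have "3 * D\<^sup>2 * h2 / ((real k + 1) * (real k + 2))
        = 18 * \<L> * D\<^sup>2 / ((real k + 2) * real m) * ((real k - 1) / (real k + 1))"
      using m by (simp add: h2_def field_simps)
    also have "\<dots> \<le> 18 * \<L> * D\<^sup>2 / ((real k + 2) * real m) * 1"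
      using nonneg by (intro mult_left_mono) auto
    finally show "3 * D\<^sup>2 * h2 / ((real k + 1) * (real k + 2)) \<le> 18 * \<L> * D\<^sup>2 / ((real k + 2) * real m)"
      by simp
    have "h3 = 3 * (real k + 1) * sqrt (L * \<L>) / sqrt (real m)"
      by (simp add: h3_def real_sqrt_mult real_sqrt_divide mult.assoc)
    then have "6 * D\<^sup>2 * h3 / ((real k + 1) * (real k + 2))
        = 6 * D\<^sup>2 * (3 * (real k + 1) * sqrt (L * \<L>) / sqrt (real m)) / ((real k + 1) * (real k + 2))"
      by (simp only:)
    also have "\<dots> = 18 * D\<^sup>2 * sqrt (L * \<L>) / ((real k + 2) * sqrt (real m))"
    proof -
      have "6 * D\<^sup>2 * (3 * c * q / s) / (c * d) = 18 * D\<^sup>2 * q / (d * s)" if "0 < c" for c d q s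
        using that by (simp add: field_simps)
      then show ?thesis
        by (meson add_nonneg_pos of_nat_0_le_iff zero_less_one)
    qed
    also have "\<dots> \<le> 18 * D\<^sup>2 * sqrt (L * \<L>) / ((real k + 1) * sqrt (real m))"
      using nonneg m by (intro divide_left_mono mult_right_mono) auto
    finally show "6 * D\<^sup>2 * h3 / ((real k + 1) * (real k + 2))
        \<le> 18 * D\<^sup>2 * sqrt (L * \<L>) / ((real k + 1) * sqrt (real m))" .
    have "6 * D\<^sup>2 * h4 / ((real k + 1) * (real k + 2))
        = \<sigma> * D * (6 * sqrt (2 * (real k + 2) ^ 3 / (3 * real m)) / ((real k + 1) * (real k + 2)))"
      using D by (simp add: h4_def field_simps power2_eq_square)
    also have "\<dots> \<le> \<sigma> * D * (4 * sqrt 2 / sqrt ((real k + 1) * real m))"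
    proof (intro mult_left_mono)
      show "6 * sqrt (2 * (real k + 2) ^ 3 / (3 * real m)) / ((real k + 1) * (real k + 2))
          \<le> 4 * sqrt 2 / sqrt ((real k + 1) * real m)"
      proof (rule power2_le_imp_le)
        have "(6 * sqrt (2 * (real k + 2) ^ 3 / (3 * real m)) / ((real k + 1) * (real k + 2)))\<^sup>2
            = 24 * (real k + 2) / ((real k + 1)\<^sup>2 * real m)"
        proof -
          have "(6 * sqrt (2 * d ^ 3 / (3 * r)) / (c * d))\<^sup>2 = 24 * d / (c\<^sup>2 * r)"
            if "0 < d" "0 < r" for c d r
            using that by (simp add: power_divide power_mult_distrib field_simps power2_eq_square power3_eq_cube)
          then show ?thesis
            using m by simp
        qed
        \<comment> \<open>This is \<open>24 * (k + 2) \<le> 32 * (k + 1)\<close>, with equality at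
          \<open>k = 2\<close>; the assumption on \<open>k\<close> makes the constant
          \<open>4 * sqrt 2\<close> possible.\<close>
        also have "\<dots> \<le> 32 * (real k + 1) / ((real k + 1)\<^sup>2 * real m)"
          using k by (intro divide_right_mono) auto
        also have "\<dots> = (4 * sqrt 2 / sqrt ((real k + 1) * real m))\<^sup>2"
        proof -
          have "32 * c / (c\<^sup>2 * r) = (4 * sqrt 2 / sqrt (c * r))\<^sup>2" if "0 < c" "0 < r" for c r
          proof -
            have "32 * c / (c\<^sup>2 * r) = 32 / (c * r)"
              using that by (simp add: power2_eq_square)
            then show ?thesis
              using that by (simp add: power_divide power_mult_distrib)
          qed
          from this[of "real k + 1" "real m"] show ?thesis
            using m by simp
        qed
        finally show "(6 * sqrt (2 * (real k + 2) ^ 3 / (3 * real m)) / ((real k + 1) * (real k + 2)))\<^sup>2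
          \<le> (4 * sqrt 2 / sqrt ((real k + 1) * real m))\<^sup>2" .
      qed simp
    qed (use nonneg D in simp)
    finally show "6 * D\<^sup>2 * h4 / ((real k + 1) * (real k + 2))
        \<le> 4 * \<sigma> * D * sqrt 2 / sqrt ((real k + 1) * real m)"
      by (simp add: mult.assoc mult.left_commute)
  qed
  finally show ?thesis
    by (simp add: mult.assoc mult.left_commute)
qed

section \<open>Independent samples\<close>

text \<open>The sigma-algebra on the sample space generated by the variables indexed by
  \<open>I\<close>. Pulling back one product-valued map makes independence of disjoint blocks of
  variables directly applicable; for empty \<open>I\<close> it is trivial.\<close>

definition sample_algebra ::
  "'w measure \<Rightarrow> 's measure \<Rightarrow> ('i \<Rightarrow> 'w \<Rightarrow> 's) \<Rightarrow> 'i set \<Rightarrow> 'w measure" where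
  "sample_algebra M S Y I = vimage_algebra (space M) (\<lambda>\<omega>. \<lambda>p\<in>I. Y p \<omega>) (PiM I (\<lambda>_. S))"

lemma space_sample_algebra [simp]: "space (sample_algebra M S Y I) = space M"
  by (simp add: sample_algebra_def)

lemma sample_map_in_PiM:
  assumes "\<And>p. p \<in> I \<Longrightarrow> Y p \<in> measurable M S"
  shows "(\<lambda>\<omega>. \<lambda>p\<in>I. Y p \<omega>) \<in> space M \<rightarrow> space (PiM I (\<lambda>_. S))"
  using measurable_space[OF assms] by (auto simp: space_PiM)

lemma measurable_sample:
  assumes "\<And>p. p \<in> I \<Longrightarrow> Y p \<in> measurable M S" and "p \<in> I"
  shows "Y p \<in> measurable (sample_algebra M S Y I) S"
proof -
  have "(\<lambda>\<omega>. \<lambda>p\<in>I. Y p \<omega>) \<in> measurable (sample_algebra M S Y I) (PiM I (\<lambda>_. S))"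
    unfolding sample_algebra_def
    by (rule measurable_vimage_algebra1[OF sample_map_in_PiM]) (rule assms(1))
  from measurable_compose[OF this measurable_component_singleton[OF assms(2)]] show ?thesis
    using assms(2) by simp
qed

lemma measurable_sample_algebra_mono:
  assumes "\<And>p. p \<in> J \<Longrightarrow> Y p \<in> measurable M S" and "I \<subseteq> J"
    and "h \<in> measurable (sample_algebra M S Y I) R"
  shows "h \<in> measurable (sample_algebra M S Y J) R"
proof -
  have "(\<lambda>\<omega>. \<omega>) \<in> measurable (sample_algebra M S Y J) (sample_algebra M S Y I)"
    unfolding sample_algebra_def[of _ _ _ I]
  proof (rule measurable_vimage_algebra2)
    show "(\<lambda>\<omega>. \<lambda>p\<in>I. Y p \<omega>) \<in> measurable (sample_algebra M S Y J) (PiM I (\<lambda>_. S))"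
      by (rule measurable_restrict) (use assms in \<open>auto intro: measurable_sample\<close>)
  qed simp
  from measurable_compose[OF this assms(3)] show ?thesis .
qed

lemma measurable_from_sample_algebra:
  assumes "\<And>p. p \<in> I \<Longrightarrow> Y p \<in> measurable M S"
    and "h \<in> measurable (sample_algebra M S Y I) R"
  shows "h \<in> measurable M R"
proof -
  have "(\<lambda>\<omega>. \<omega>) \<in> measurable M (sample_algebra M S Y I)"
    unfolding sample_algebra_def
    by (rule measurable_vimage_algebra2) (use assms(1) in \<open>auto intro: measurable_restrict\<close>)
  from measurable_compose[OF this assms(2)] show ?thesis .
qed

text \<open>\<open>indep_var\<close> would require \<open>F\<close> and \<open>S\<close> to live on the same type.\<close>

definition (in prob_space) indep_of :: "'a measure \<Rightarrow> 's measure \<Rightarrow> ('a \<Rightarrow> 's) \<Rightarrow> bool" where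
  "indep_of F S Y \<longleftrightarrow> (\<lambda>\<omega>. \<omega>) \<in> measurable M F \<and> Y \<in> measurable M S \<and>
     distr M F (\<lambda>\<omega>. \<omega>) \<Otimes>\<^sub>M distr M S Y = distr M (F \<Otimes>\<^sub>M S) (\<lambda>\<omega>. (\<omega>, Y \<omega>))"

text \<open>Disjoint blocks of an independent family are independent, and \<open>Y p\<close> is
  recovered from the block \<open>{p}\<close>. The two measures on the product are then compared on
  rectangles.\<close>

lemma (in prob_space) indep_of_sample_algebra:
  assumes indep: "indep_vars (\<lambda>_. S) Y J" and IJ: "I \<subseteq> J" "p \<in> J" "p \<notin> I"
  shows "indep_of (sample_algebra M S Y I) S (Y p)"
proof -
  let ?R = "\<lambda>\<omega>. \<lambda>q\<in>I. Y q \<omega>" and ?R' = "\<lambda>\<omega>. \<lambda>q\<in>{p}. Y q \<omega>"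
  let ?F = "sample_algebra M S Y I"
  have meas: "Y q \<in> measurable M S" if "q \<in> J" for q
    using indep that by (auto simp: indep_vars_def)
  have Yp [measurable]: "Y p \<in> measurable M S"
    using IJ meas by simp
  have id [measurable]: "(\<lambda>\<omega>. \<omega>) \<in> measurable M ?F"
    by (rule measurable_from_sample_algebra[of I]) (use IJ meas in auto)
  have ind: "indep_var (PiM I (\<lambda>_. S)) ?R (PiM {p} (\<lambda>_. S)) ?R'"
    by (rule indep_var_restrict[OF indep]) (use IJ in auto)
  have prob_Int: "prob (A \<inter> (Y p -` B \<inter> space M)) = prob A * prob (Y p -` B \<inter> space M)"
    if A: "A \<in> sets ?F" and B: "B \<in> sets S" for A B
  proof -
    have "sets ?F = {?R -` C \<inter> space M | C. C \<in> sets (PiM I (\<lambda>_. S))}"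
      unfolding sample_algebra_def
      by (rule sets_vimage_algebra2[OF sample_map_in_PiM]) (use IJ meas in auto)
    then obtain C where C: "C \<in> sets (PiM I (\<lambda>_. S))" "A = ?R -` C \<inter> space M"
      using A by auto
    define B' where "B' = (\<lambda>h. h p) -` B \<inter> space (PiM {p} (\<lambda>_. S))"
    have "B' \<in> sets (PiM {p} (\<lambda>_. S))"
      unfolding B'_def using B by (intro measurable_sets[OF measurable_component_singleton]) auto
    moreover have "?R' -` B' \<inter> space M = Y p -` B \<inter> space M"
      using measurable_space[OF Yp] by (auto simp: B'_def space_PiM)
    moreover have "(\<lambda>\<omega>. (?R \<omega>, ?R' \<omega>)) -` (C \<times> B') \<inter> space M
        = (?R -` C \<inter> space M) \<inter> (?R' -` B' \<inter> space M)"
      by auto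
    ultimately show ?thesis
      using indep_varD[OF ind C(1), of B'] C(2) by simp
  qed
  interpret F: prob_space "distr M ?F (\<lambda>\<omega>. \<omega>)"
    by (rule prob_space_distr) (rule id)
  interpret Y: prob_space "distr M S (Y p)"
    by (rule prob_space_distr) (rule Yp)
  have "distr M ?F (\<lambda>\<omega>. \<omega>) \<Otimes>\<^sub>M distr M S (Y p) = distr M (?F \<Otimes>\<^sub>M S) (\<lambda>\<omega>. (\<omega>, Y p \<omega>))"
  proof (rule pair_measure_eqI)
    fix A B assume AB: "A \<in> sets (distr M ?F (\<lambda>\<omega>. \<omega>))" "B \<in> sets (distr M S (Y p))"
    then have A: "A \<inter> space M = A"
      using sets.sets_into_space[of A ?F] by auto
    have "(\<lambda>\<omega>. (\<omega>, Y p \<omega>)) -` (A \<times> B) \<inter> space M = A \<inter> (Y p -` B \<inter> space M)"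
      using A by auto
    then show "emeasure (distr M ?F (\<lambda>\<omega>. \<omega>)) A * emeasure (distr M S (Y p)) B
        = emeasure (distr M (?F \<Otimes>\<^sub>M S) (\<lambda>\<omega>. (\<omega>, Y p \<omega>))) (A \<times> B)"
      using AB A prob_Int[of A B]
      by (simp add: emeasure_distr emeasure_eq_measure ennreal_mult[symmetric])
  qed (auto intro: F.sigma_finite_measure_axioms Y.sigma_finite_measure_axioms)
  then show ?thesis
    unfolding indep_of_def using id Yp by blast
qed

text \<open>Fubini for the product law: the past is frozen at \<open>\<omega>\<close> and only the
  fresh sample is averaged. The nonnegative version comes without integrability, which the variance
  bound still has to produce.\<close>

lemma (in prob_space) indep_of_nn_integral:
  assumes ind: "indep_of F S Y" and h: "h \<in> borel_measurable (F \<Otimes>\<^sub>M S)"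
  shows "(\<integral>\<^sup>+\<omega>. h (\<omega>, Y \<omega>) \<partial>M) = (\<integral>\<^sup>+\<omega>. (\<integral>\<^sup>+\<omega>'. h (\<omega>, Y \<omega>') \<partial>M) \<partial>M)"
proof -
  have id [measurable]: "(\<lambda>\<omega>. \<omega>) \<in> measurable M F" and Y [measurable]: "Y \<in> measurable M S"
    and distr: "distr M F (\<lambda>\<omega>. \<omega>) \<Otimes>\<^sub>M distr M S Y = distr M (F \<Otimes>\<^sub>M S) (\<lambda>\<omega>. (\<omega>, Y \<omega>))"
    using ind by (auto simp: indep_of_def)
  note h [measurable]
  interpret Y: prob_space "distr M S Y"
    by (rule prob_space_distr) (rule Y)
  have "(\<integral>\<^sup>+\<omega>. h (\<omega>, Y \<omega>) \<partial>M) = (\<integral>\<^sup>+q. h q \<partial>(distr M F (\<lambda>\<omega>. \<omega>) \<Otimes>\<^sub>M distr M S Y))"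
    unfolding distr by (subst nn_integral_distr) auto
  also have "\<dots> = (\<integral>\<^sup>+\<omega>. (\<integral>\<^sup>+s. h (\<omega>, s) \<partial>distr M S Y) \<partial>distr M F (\<lambda>\<omega>. \<omega>))"
    by (rule Y.nn_integral_fst[symmetric]) simp
  also have "\<dots> = (\<integral>\<^sup>+\<omega>. (\<integral>\<^sup>+s. h (\<omega>, s) \<partial>distr M S Y) \<partial>M)"
    by (rule nn_integral_distr) (auto intro!: Y.borel_measurable_nn_integral_fst)
  also have "\<dots> = (\<integral>\<^sup>+\<omega>. (\<integral>\<^sup>+\<omega>'. h (\<omega>, Y \<omega>') \<partial>M) \<partial>M)"
  proof (rule nn_integral_cong)
    fix \<omega> assume "\<omega> \<in> space M"
    then have "\<omega> \<in> space F"
      using measurable_space[OF id] by auto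
    then show "(\<integral>\<^sup>+s. h (\<omega>, s) \<partial>distr M S Y) = (\<integral>\<^sup>+\<omega>'. h (\<omega>, Y \<omega>') \<partial>M)"
      by (intro nn_integral_distr) auto
  qed
  finally show ?thesis .
qed

lemma (in prob_space) indep_of_integral:
  fixes h :: "_ \<Rightarrow> real"
  assumes ind: "indep_of F S Y" and h: "h \<in> borel_measurable (F \<Otimes>\<^sub>M S)"
    and int: "integrable M (\<lambda>\<omega>. h (\<omega>, Y \<omega>))"
  shows "(\<integral>\<omega>. h (\<omega>, Y \<omega>) \<partial>M) = (\<integral>\<omega>. (\<integral>\<omega>'. h (\<omega>, Y \<omega>') \<partial>M) \<partial>M)"
proof -
  have id [measurable]: "(\<lambda>\<omega>. \<omega>) \<in> measurable M F" and Y [measurable]: "Y \<in> measurable M S"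
    and distr: "distr M F (\<lambda>\<omega>. \<omega>) \<Otimes>\<^sub>M distr M S Y = distr M (F \<Otimes>\<^sub>M S) (\<lambda>\<omega>. (\<omega>, Y \<omega>))"
    using ind by (auto simp: indep_of_def)
  note h [measurable]
  interpret F: prob_space "distr M F (\<lambda>\<omega>. \<omega>)"
    by (rule prob_space_distr) (rule id)
  interpret Y: prob_space "distr M S Y"
    by (rule prob_space_distr) (rule Y)
  interpret P: pair_prob_space "distr M F (\<lambda>\<omega>. \<omega>)" "distr M S Y" ..
  have int': "integrable (distr M F (\<lambda>\<omega>. \<omega>) \<Otimes>\<^sub>M distr M S Y) h"
    unfolding distr using int by (subst integrable_distr_eq) auto
  have "(\<integral>\<omega>. h (\<omega>, Y \<omega>) \<partial>M) = (\<integral>q. h q \<partial>(distr M F (\<lambda>\<omega>. \<omega>) \<Otimes>\<^sub>M distr M S Y))"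
    unfolding distr by (subst integral_distr) auto
  also have "\<dots> = (\<integral>\<omega>. (\<integral>s. h (\<omega>, s) \<partial>distr M S Y) \<partial>distr M F (\<lambda>\<omega>. \<omega>))"
    by (rule P.integral_fst'[OF int', symmetric])
  also have "\<dots> = (\<integral>\<omega>. (\<integral>s. h (\<omega>, s) \<partial>distr M S Y) \<partial>M)"
    by (rule integral_distr) (auto intro!: Y.borel_measurable_lebesgue_integral)
  also have "\<dots> = (\<integral>\<omega>. (\<integral>\<omega>'. h (\<omega>, Y \<omega>') \<partial>M) \<partial>M)"
  proof (rule Bochner_Integration.integral_cong[OF refl])
    fix \<omega> assume "\<omega> \<in> space M"
    then have "\<omega> \<in> space F"
      using measurable_space[OF id] by auto
    then show "(\<integral>s. h (\<omega>, s) \<partial>distr M S Y) = (\<integral>\<omega>'. h (\<omega>, Y \<omega>') \<partial>M)"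
      by (intro integral_distr) auto
  qed
  finally show ?thesis .
qed

section \<open>Noise of an unbiased oracle at a random query point\<close>

context prob_space
begin

context
  fixes X :: "'b::euclidean_space set" and S :: "'s measure" and Or :: "'b \<Rightarrow> 's \<Rightarrow> 'b"
    and g :: "'b \<Rightarrow> 'b" and Y :: "'a \<Rightarrow> 's"
  assumes Or: "(\<lambda>(v, s). Or v s) \<in> borel_measurable (restrict_space borel X \<Otimes>\<^sub>M S)"
    and Y: "Y \<in> measurable M S"
    and unbiased: "\<And>v. v \<in> X \<Longrightarrow> has_bochner_integral M (\<lambda>\<omega>. Or v (Y \<omega>)) (g v)"
begin

lemma measurable_oracle_at: "v \<in> X \<Longrightarrow> Or v \<in> borel_measurable S"
proof -
  assume "v \<in> X"
  then have "Pair v \<in> measurable S (restrict_space borel X \<Otimes>\<^sub>M S)"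
    by (intro measurable_Pair1') (simp add: space_restrict_space)
  from measurable_compose[OF this Or] show ?thesis by simp
qed

text \<open>By unbiasedness \<open>g\<close> is, on \<open>X\<close>, a parameter integral of the
  jointly measurable oracle. No regularity of the gradient is required.\<close>

lemma measurable_oracle_mean: "g \<in> borel_measurable (restrict_space borel X)"
proof -
  interpret Y: prob_space "distr M S Y"
    by (rule prob_space_distr) (rule Y)
  have "(\<lambda>v. \<integral>s. Or v s \<partial>distr M S Y) \<in> borel_measurable (restrict_space borel X)"
    by (rule Y.borel_measurable_lebesgue_integral)
      (use Or in \<open>simp cong: measurable_cong_sets sets_pair_measure_cong\<close>)
  moreover have "(\<integral>s. Or v s \<partial>distr M S Y) = g v" if "v \<in> X" for v
    using unbiased[OF that] measurable_oracle_at[OF that] Y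
    by (simp add: integral_distr has_bochner_integral_iff)
  ultimately show ?thesis
    by (subst measurable_cong[where g = "\<lambda>v. \<integral>s. Or v s \<partial>distr M S Y"])
      (auto simp: space_restrict_space)
qed

lemma measurable_oracle_noise:
  assumes "y \<in> measurable F (restrict_space borel X)" "Y' \<in> measurable F S"
  shows "(\<lambda>\<omega>. Or (y \<omega>) (Y' \<omega>) - g (y \<omega>)) \<in> borel_measurable F"
proof -
  have "(\<lambda>\<omega>. (\<lambda>(v, s). Or v s) (y \<omega>, Y' \<omega>)) \<in> borel_measurable F"
    by (rule measurable_compose[OF measurable_Pair[OF assms] Or])
  moreover have "(\<lambda>\<omega>. g (y \<omega>)) \<in> borel_measurable F"
    by (rule measurable_compose[OF assms(1) measurable_oracle_mean])
  ultimately show ?thesis by simp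
qed

context
  fixes F :: "'a measure" and y :: "'a \<Rightarrow> 'b"
  assumes ind: "indep_of F S Y" and y: "y \<in> measurable F (restrict_space borel X)"
begin

lemma frozen_id: "(\<lambda>\<omega>. \<omega>) \<in> measurable M F"
  using ind by (simp add: indep_of_def)

lemma frozen_point: "\<omega> \<in> space M \<Longrightarrow> y \<omega> \<in> X"
  using measurable_space[OF frozen_id] measurable_space[OF y]
  by (auto simp: space_restrict_space)

lemma measurable_noise_pair:
  "(\<lambda>(\<omega>, s). Or (y \<omega>) s - g (y \<omega>)) \<in> borel_measurable (F \<Otimes>\<^sub>M S)"
proof -
  have "(\<lambda>q. Or (y (fst q)) (snd q) - g (y (fst q))) \<in> borel_measurable (F \<Otimes>\<^sub>M S)"
    by (rule measurable_oracle_noise) (auto intro: measurable_compose[OF measurable_fst y])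
  then show ?thesis by (simp add: case_prod_unfold)
qed

text \<open>With the past frozen, both \<open>y\<close> and \<open>a\<close> are constants, and
  unbiasedness at the point \<open>y \<omega>\<close> makes the inner integral vanish.\<close>

lemma oracle_noise_mean_zero:
  assumes a: "a \<in> borel_measurable F"
    and int: "integrable M (\<lambda>\<omega>. (Or (y \<omega>) (Y \<omega>) - g (y \<omega>)) \<bullet> a \<omega>)"
  shows "(\<integral>\<omega>. (Or (y \<omega>) (Y \<omega>) - g (y \<omega>)) \<bullet> a \<omega> \<partial>M) = 0"
proof -
  define h where "h = (\<lambda>(\<omega>, s). (Or (y \<omega>) s - g (y \<omega>)) \<bullet> a \<omega>)"
  have "(\<lambda>q. (\<lambda>(\<omega>, s). Or (y \<omega>) s - g (y \<omega>)) q \<bullet> a (fst q)) \<in> borel_measurable (F \<Otimes>\<^sub>M S)"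
    by (intro borel_measurable_inner measurable_noise_pair measurable_compose[OF measurable_fst a])
  then have "h \<in> borel_measurable (F \<Otimes>\<^sub>M S)"
    by (simp add: h_def case_prod_unfold)
  then have "(\<integral>\<omega>. h (\<omega>, Y \<omega>) \<partial>M) = (\<integral>\<omega>. (\<integral>\<omega>'. h (\<omega>, Y \<omega>') \<partial>M) \<partial>M)"
    by (rule indep_of_integral[OF ind]) (use int in \<open>simp add: h_def\<close>)
  also have "\<dots> = (\<integral>\<omega>. 0 \<partial>M)"
  proof (rule Bochner_Integration.integral_cong[OF refl])
    fix \<omega> assume "\<omega> \<in> space M"
    then have "has_bochner_integral M (\<lambda>\<omega>'. Or (y \<omega>) (Y \<omega>')) (g (y \<omega>))"
      by (intro unbiased frozen_point)
    then show "(\<integral>\<omega>'. h (\<omega>, Y \<omega>') \<partial>M) = 0"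
      by (simp add: h_def has_bochner_integral_iff prob_space)
  qed
  finally show ?thesis by (simp add: h_def)
qed

text \<open>Carries a variance bound at deterministic points over to a query point that depends on
  the past. Working in \<open>ennreal\<close> makes integrability a result of the same
  estimate.\<close>

lemma oracle_noise_variance:
  fixes \<phi> B :: "'b \<Rightarrow> real"
  assumes \<phi>: "\<phi> \<in> borel_measurable borel" "\<And>v. 0 \<le> \<phi> v"
    and var: "\<And>v. v \<in> X \<Longrightarrow> integrable M (\<lambda>\<omega>. \<phi> (Or v (Y \<omega>) - g v))"
      "\<And>v. v \<in> X \<Longrightarrow> (\<integral>\<omega>. \<phi> (Or v (Y \<omega>) - g v) \<partial>M) \<le> B v"
    and B: "integrable M (\<lambda>\<omega>. B (y \<omega>))"
  shows "integrable M (\<lambda>\<omega>. \<phi> (Or (y \<omega>) (Y \<omega>) - g (y \<omega>)))"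
    and "(\<integral>\<omega>. \<phi> (Or (y \<omega>) (Y \<omega>) - g (y \<omega>)) \<partial>M) \<le> (\<integral>\<omega>. B (y \<omega>) \<partial>M)"
proof -
  define h where "h = (\<lambda>(\<omega>, s). ennreal (\<phi> (Or (y \<omega>) s - g (y \<omega>))))"
  have B_nonneg: "0 \<le> B v" if "v \<in> X" for v
    by (rule order_trans[OF Bochner_Integration.integral_nonneg var(2)[OF that]]) (rule \<phi>(2))
  have h: "h \<in> borel_measurable (F \<Otimes>\<^sub>M S)"
    using measurable_compose[OF measurable_compose[OF measurable_noise_pair \<phi>(1)] measurable_ennreal]
    by (simp add: h_def case_prod_unfold)
  have "(\<integral>\<^sup>+\<omega>. h (\<omega>, Y \<omega>) \<partial>M) = (\<integral>\<^sup>+\<omega>. (\<integral>\<^sup>+\<omega>'. h (\<omega>, Y \<omega>') \<partial>M) \<partial>M)"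
    by (rule indep_of_nn_integral[OF ind h])
  also have "\<dots> \<le> (\<integral>\<^sup>+\<omega>. ennreal (B (y \<omega>)) \<partial>M)"
  proof (rule nn_integral_mono)
    fix \<omega> assume "\<omega> \<in> space M"
    then have v: "y \<omega> \<in> X"
      by (rule frozen_point)
    show "(\<integral>\<^sup>+\<omega>'. h (\<omega>, Y \<omega>') \<partial>M) \<le> ennreal (B (y \<omega>))"
      using var[OF v] \<phi>(2) by (simp add: h_def nn_integral_eq_integral ennreal_leI)
  qed
  also have "\<dots> = ennreal (\<integral>\<omega>. B (y \<omega>) \<partial>M)"
    using B frozen_point B_nonneg by (intro nn_integral_eq_integral) auto
  finally have le: "(\<integral>\<^sup>+\<omega>. ennreal (\<phi> (Or (y \<omega>) (Y \<omega>) - g (y \<omega>))) \<partial>M) \<le> ennreal (\<integral>\<omega>. B (y \<omega>) \<partial>M)"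
    by (simp add: h_def)
  have "y \<in> measurable M (restrict_space borel X)"
    using measurable_compose[OF frozen_id y] by simp
  then have meas: "(\<lambda>\<omega>. \<phi> (Or (y \<omega>) (Y \<omega>) - g (y \<omega>))) \<in> borel_measurable M"
    by (rule measurable_compose[OF measurable_oracle_noise[OF _ Y] \<phi>(1)])
  show int: "integrable M (\<lambda>\<omega>. \<phi> (Or (y \<omega>) (Y \<omega>) - g (y \<omega>)))"
    by (rule integrableI_bounded[OF meas])
      (use le \<phi>(2) in \<open>auto intro: le_less_trans\<close>)
  have "ennreal (\<integral>\<omega>. \<phi> (Or (y \<omega>) (Y \<omega>) - g (y \<omega>)) \<partial>M) \<le> ennreal (\<integral>\<omega>. B (y \<omega>) \<partial>M)"
    using le by (simp add: nn_integral_eq_integral[OF int] \<phi>(2))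
  moreover have "0 \<le> (\<integral>\<omega>. B (y \<omega>) \<partial>M)"
    using frozen_point B_nonneg by (intro Bochner_Integration.integral_nonneg) auto
  ultimately show "(\<integral>\<omega>. \<phi> (Or (y \<omega>) (Y \<omega>) - g (y \<omega>)) \<partial>M) \<le> (\<integral>\<omega>. B (y \<omega>) \<partial>M)"
    by simp
qed

end

end

end

section \<open>Square-integrable random vectors\<close>

lemma integrable_norm_sq_add:
  fixes a b :: "'w \<Rightarrow> 'b::euclidean_space"
  assumes [measurable]: "a \<in> borel_measurable M" "b \<in> borel_measurable M"
    and "integrable M (\<lambda>\<omega>. (norm (a \<omega>))\<^sup>2)" "integrable M (\<lambda>\<omega>. (norm (b \<omega>))\<^sup>2)"
  shows "integrable M (\<lambda>\<omega>. (norm (a \<omega> + b \<omega>))\<^sup>2)"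
proof (rule Bochner_Integration.integrable_bound)
  show "integrable M (\<lambda>\<omega>. 2 * (norm (a \<omega>))\<^sup>2 + 2 * (norm (b \<omega>))\<^sup>2)"
    using assms by simp
  have "(norm (a \<omega> + b \<omega>))\<^sup>2 \<le> 2 * (norm (a \<omega>))\<^sup>2 + 2 * (norm (b \<omega>))\<^sup>2" for \<omega>
  proof -
    have "(norm (a \<omega> + b \<omega>))\<^sup>2 \<le> (norm (a \<omega>) + norm (b \<omega>))\<^sup>2"
      by (simp add: norm_triangle_ineq power_mono)
    also have "\<dots> \<le> 2 * (norm (a \<omega>))\<^sup>2 + 2 * (norm (b \<omega>))\<^sup>2"
      using sum_squares_bound[of "norm (a \<omega>)" "norm (b \<omega>)"] by (simp add: power2_sum)
    finally show ?thesis .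
  qed
  then show "AE \<omega> in M. norm ((norm (a \<omega> + b \<omega>))\<^sup>2) \<le> norm (2 * (norm (a \<omega>))\<^sup>2 + 2 * (norm (b \<omega>))\<^sup>2)"
    by simp
qed measurable

lemma integrable_norm_sq_sum:
  fixes a :: "'i \<Rightarrow> 'w \<Rightarrow> 'b::euclidean_space"
  assumes "finite I" and "\<And>i. i \<in> I \<Longrightarrow> a i \<in> borel_measurable M"
    and "\<And>i. i \<in> I \<Longrightarrow> integrable M (\<lambda>\<omega>. (norm (a i \<omega>))\<^sup>2)"
  shows "integrable M (\<lambda>\<omega>. (norm (\<Sum>i\<in>I. a i \<omega>))\<^sup>2)"
  using assms
proof (induction I)
  case (insert i I)
  then show ?case
    by (auto intro!: integrable_norm_sq_add borel_measurable_sum)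
qed simp

lemma integrable_inner_of_norm_sq:
  fixes a b :: "'w \<Rightarrow> 'b::euclidean_space"
  assumes [measurable]: "a \<in> borel_measurable M" "b \<in> borel_measurable M"
    and "integrable M (\<lambda>\<omega>. (norm (a \<omega>))\<^sup>2)" "integrable M (\<lambda>\<omega>. (norm (b \<omega>))\<^sup>2)"
  shows "integrable M (\<lambda>\<omega>. a \<omega> \<bullet> b \<omega>)"
proof (rule Bochner_Integration.integrable_bound)
  show "integrable M (\<lambda>\<omega>. (norm (a \<omega>))\<^sup>2 + (norm (b \<omega>))\<^sup>2)"
    using assms by simp
  have "\<bar>a \<omega> \<bullet> b \<omega>\<bar> \<le> (norm (a \<omega>))\<^sup>2 + (norm (b \<omega>))\<^sup>2" for \<omega>
    using Cauchy_Schwarz_ineq2[of "a \<omega>" "b \<omega>"] sum_squares_bound[of "norm (a \<omega>)" "norm (b \<omega>)"]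
      mult_nonneg_nonneg[OF norm_ge_zero[of "a \<omega>"] norm_ge_zero[of "b \<omega>"]] by linarith
  then show "AE \<omega> in M. norm (a \<omega> \<bullet> b \<omega>) \<le> norm ((norm (a \<omega>))\<^sup>2 + (norm (b \<omega>))\<^sup>2)"
    by simp
qed measurable

section \<open>The expected step\<close>

locale sagd_process = smooth_objective N X w dw x0 f g L xs + prob_space M
  for N :: "'a::euclidean_space \<Rightarrow> real" and X w dw x0 f g L xs and M :: "'w measure" +
  fixes S :: "'s measure" and \<xi> :: "nat \<Rightarrow> nat \<Rightarrow> 'w \<Rightarrow> 's" and Or :: "'a \<Rightarrow> 's \<Rightarrow> 'a"
    and \<L> \<sigma> \<eta> :: real and m :: nat and z y x :: "nat \<Rightarrow> 'w \<Rightarrow> 'a"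
  assumes convex_f: "convex_on X f" and continuous_f: "continuous_on X f"
    and continuous_dw: "continuous_on UNIV dw"
    and oracle_measurable: "(\<lambda>(v, s). Or v s) \<in> borel_measurable (restrict_space borel X \<Otimes>\<^sub>M S)"
    and m_ge_1: "1 \<le> m"
    and indep: "indep_vars (\<lambda>_. S) (\<lambda>(t, i). \<xi> t i) (UNIV \<times> {1..m})"
    and unbiased: "v \<in> X \<Longrightarrow> i \<in> {1..m} \<Longrightarrow> has_bochner_integral M (\<lambda>\<omega>. Or v (\<xi> t i \<omega>)) (g v)"
    and \<L>_nonneg: "0 \<le> \<L>"
    and variance: "v \<in> X \<Longrightarrow> i \<in> {1..m} \<Longrightarrow> integrable M (\<lambda>\<omega>. (dual_norm N (Or v (\<xi> t i \<omega>) - g v))\<^sup>2)"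
      "v \<in> X \<Longrightarrow> i \<in> {1..m} \<Longrightarrow>
        (\<integral>\<omega>. (dual_norm N (Or v (\<xi> t i \<omega>) - g v))\<^sup>2 \<partial>M) \<le> \<L> * gap v + \<sigma>\<^sup>2"
    and \<eta>: "0 < \<eta>" "4 * L \<le> \<eta>"
    and sagd: "\<omega> \<in> space M \<Longrightarrow>
      sagd X (bregman w dw x0) Or (\<lambda>t. 3 / (real t + 2)) (\<lambda>t. \<eta> / (real t + 1)) (\<lambda>_. m) x0
        (\<lambda>t i. \<xi> t i \<omega>) (\<lambda>t. z t \<omega>) (\<lambda>t. y t \<omega>) (\<lambda>t. x t \<omega>)"
begin

text \<open>The parameters and the noise are indexed by the number \<open>n\<close> of completed steps, that is, they
  belong to step \<open>Suc n\<close>.\<close>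

definition \<beta> :: "nat \<Rightarrow> real" where "\<beta> n = 3 / (real n + 3)"
definition e :: "nat \<Rightarrow> real" where "e n = \<eta> / (real n + 2)"
definition K :: "nat \<Rightarrow> real" where "K n = 4 / (real m * e n)"
definition \<delta> :: "nat \<Rightarrow> nat \<Rightarrow> 'w \<Rightarrow> 'a" where
  "\<delta> n i \<omega> = Or (y (Suc n) \<omega>) (\<xi> (Suc n) i \<omega>) - g (y (Suc n) \<omega>)"
text \<open>Dual vectors that the algorithm itself does not visit: to the mirror image of
  \<open>z n\<close> only the scaled errors of the first \<open>j\<close> samples are added, without
  the gradient.\<close>

definition dual_pt :: "nat \<Rightarrow> nat \<Rightarrow> 'w \<Rightarrow> 'a" where
  "dual_pt n j \<omega> = dw (z n \<omega> - x0) + (\<Sum>i=1..j. - K n *\<^sub>R \<delta> n i \<omega>)"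
text \<open>The filtration runs within batches: all samples of the first \<open>n\<close> steps and
  the first \<open>j\<close> of the step in progress. Steps count from 1, so
  \<open>samples 0 0\<close> is empty.\<close>

definition samples :: "nat \<Rightarrow> nat \<Rightarrow> (nat \<times> nat) set" where
  "samples n j = {1..n} \<times> {1..m} \<union> {Suc n} \<times> {1..j}"
definition past :: "nat \<Rightarrow> nat \<Rightarrow> 'w measure" where
  "past n j = sample_algebra M S (\<lambda>(t, i). \<xi> t i) (samples n j)"

lemma \<beta>_bounds: "0 \<le> \<beta> n" "\<beta> n \<le> 1" and \<beta>_pos: "0 < \<beta> n" and e_pos: "0 < e n"
  using \<eta> by (auto simp: \<beta>_def e_def)

lemma step_size: "L * \<beta> n \<le> 3 / 4 * e n"
proof -
  have "L * \<beta> n = 3 / 4 * ((4 * L) / (real n + 3))"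
    by (simp add: \<beta>_def)
  also have "\<dots> \<le> 3 / 4 * (\<eta> / (real n + 2))"
    using \<eta> L_nonneg by (intro mult_left_mono frac_le) auto
  finally show ?thesis by (simp add: e_def)
qed

lemma start: "\<omega> \<in> space M \<Longrightarrow> z 0 \<omega> = x0" "\<omega> \<in> space M \<Longrightarrow> x 0 \<omega> = x0"
  using sagd by (auto simp: sagd_def)

lemma step:
  assumes "\<omega> \<in> space M"
  shows "y (Suc n) \<omega> = (1 - \<beta> n) *\<^sub>R x n \<omega> + \<beta> n *\<^sub>R z n \<omega>"
    and "x (Suc n) \<omega> = (1 - \<beta> n) *\<^sub>R x n \<omega> + \<beta> n *\<^sub>R z (Suc n) \<omega>"
    and "z (Suc n) \<omega> = prox (dw (z n \<omega> - x0)
      - (1 / e n) *\<^sub>R (g (y (Suc n) \<omega>) + (1 / real m) *\<^sub>R (\<Sum>i=1..m. \<delta> n i \<omega>)))"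
proof -
  have eqs: "3 / (real (Suc n) + 2) = \<beta> n" "\<eta> / (real (Suc n) + 1) = e n"
    by (simp_all add: \<beta>_def e_def add.commute)
  have batch: "batch_mean Or m (\<lambda>i. \<xi> (Suc n) i \<omega>) (y (Suc n) \<omega>)
      = g (y (Suc n) \<omega>) + (1 / real m) *\<^sub>R (\<Sum>i=1..m. \<delta> n i \<omega>)"
    using m_ge_1 by (simp add: batch_mean_def \<delta>_def sum_subtractf scaleR_diff_right sum_constant_scaleR)
  have all: "\<forall>t\<ge>1. y t \<omega> = (1 - 3 / (real t + 2)) *\<^sub>R x (t - 1) \<omega> + (3 / (real t + 2)) *\<^sub>R z (t - 1) \<omega> \<and>
      is_arg_min (\<lambda>v. batch_mean Or m (\<lambda>i. \<xi> t i \<omega>) (y t \<omega>) \<bullet> v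
        + \<eta> / (real t + 1) * V (z (t - 1) \<omega>) v) (\<lambda>v. v \<in> X) (z t \<omega>) \<and>
      x t \<omega> = (1 - 3 / (real t + 2)) *\<^sub>R x (t - 1) \<omega> + (3 / (real t + 2)) *\<^sub>R z t \<omega>"
    using sagd[OF assms] unfolding sagd_def by (elim conjE)
  have conj: "y (Suc n) \<omega> = (1 - \<beta> n) *\<^sub>R x n \<omega> + \<beta> n *\<^sub>R z n \<omega> \<and>
      is_arg_min (\<lambda>v. batch_mean Or m (\<lambda>i. \<xi> (Suc n) i \<omega>) (y (Suc n) \<omega>) \<bullet> v
        + e n * V (z n \<omega>) v) (\<lambda>v. v \<in> X) (z (Suc n) \<omega>) \<and>
      x (Suc n) \<omega> = (1 - \<beta> n) *\<^sub>R x n \<omega> + \<beta> n *\<^sub>R z (Suc n) \<omega>"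
    by (rule all[rule_format, of "Suc n", unfolded eqs diff_Suc_1]) simp
  show "y (Suc n) \<omega> = (1 - \<beta> n) *\<^sub>R x n \<omega> + \<beta> n *\<^sub>R z n \<omega>"
    and "x (Suc n) \<omega> = (1 - \<beta> n) *\<^sub>R x n \<omega> + \<beta> n *\<^sub>R z (Suc n) \<omega>"
    and "z (Suc n) \<omega> = prox (dw (z n \<omega> - x0)
      - (1 / e n) *\<^sub>R (g (y (Suc n) \<omega>) + (1 / real m) *\<^sub>R (\<Sum>i=1..m. \<delta> n i \<omega>)))"
    using conj prox_step_eq[OF e_pos] unfolding batch by blast+
qed

lemma comb_in_X: "u \<in> X \<Longrightarrow> v \<in> X \<Longrightarrow> (1 - \<beta> n) *\<^sub>R u + \<beta> n *\<^sub>R v \<in> X"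
  using convexD[OF convex_X, of u v "1 - \<beta> n" "\<beta> n"] \<beta>_bounds[of n] by simp

lemma iterates_in_X:
  assumes "\<omega> \<in> space M"
  shows "z n \<omega> \<in> X" "x n \<omega> \<in> X" "y (Suc n) \<omega> \<in> X"
proof -
  have "z n \<omega> \<in> X \<and> x n \<omega> \<in> X"
  proof (induction n)
    case 0
    then show ?case using start[OF assms] x0_in by simp
  next
    case (Suc n)
    have "z (Suc n) \<omega> \<in> X"
      unfolding step(3)[OF assms] by (rule prox_in)
    with Suc show ?case
      by (simp add: step(2)[OF assms] comb_in_X)
  qed
  then show "z n \<omega> \<in> X" "x n \<omega> \<in> X" "y (Suc n) \<omega> \<in> X"
    by (simp_all add: step(1)[OF assms] comb_in_X)
qed

section \<open>Measurability of the iterates with respect to the past samples\<close>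

lemma measurable_\<xi>: "i \<in> {1..m} \<Longrightarrow> \<xi> t i \<in> measurable M S"
proof -
  assume "i \<in> {1..m}"
  then have "(\<lambda>(t, i). \<xi> t i) (t, i) \<in> measurable M S"
    using indep unfolding indep_vars_def by (metis UNIV_I mem_Sigma_iff)
  then show ?thesis by simp
qed

lemma measurable_samples: "j \<le> m \<Longrightarrow> p \<in> samples n j \<Longrightarrow> (case p of (t, i) \<Rightarrow> \<xi> t i) \<in> measurable M S"
  by (cases p) (auto simp: samples_def intro: measurable_\<xi>)

lemma samples_Suc: "samples (Suc n) 0 = samples n m"
  by (auto simp: samples_def)

lemma space_past [simp]: "space (past n j) = space M"
  by (simp add: past_def)

lemma measurable_past_mono:
  "j \<le> l \<Longrightarrow> l \<le> m \<Longrightarrow> h \<in> measurable (past n j) R \<Longrightarrow> h \<in> measurable (past n l) R"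
  unfolding past_def
  by (rule measurable_sample_algebra_mono[of "samples n l" _ _ _ "samples n j"])
    (use measurable_samples in \<open>auto simp: samples_def\<close>)

lemma measurable_past: "j \<le> m \<Longrightarrow> h \<in> measurable (past n j) R \<Longrightarrow> h \<in> measurable M R"
  unfolding past_def by (rule measurable_from_sample_algebra[OF measurable_samples])

lemma indep_past: "j \<in> {1..m} \<Longrightarrow> indep_of (past n (j - 1)) S (\<xi> (Suc n) j)"
  unfolding past_def
proof -
  assume "j \<in> {1..m}"
  then have "samples n (j - 1) \<subseteq> UNIV \<times> {1..m}" "(Suc n, j) \<in> UNIV \<times> {1..m}"
    "(Suc n, j) \<notin> samples n (j - 1)"
    by (auto simp: samples_def)
  from indep_of_sample_algebra[OF indep this]
  show "indep_of (sample_algebra M S (\<lambda>(t, i). \<xi> t i) (samples n (j - 1))) S (\<xi> (Suc n) j)"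
    by simp
qed

text \<open>Measurability of the query point is a premise because the lemma is applied inside the
  induction that establishes it.\<close>

lemma measurable_\<delta>':
  assumes "y (Suc n) \<in> measurable (past n 0) (restrict_space borel X)" "i \<in> {1..j}" "j \<le> m"
  shows "\<delta> n i \<in> borel_measurable (past n j)"
proof -
  have i: "i \<in> {1..m}" "(Suc n, i) \<in> samples n j"
    using assms by (auto simp: samples_def)
  have "(\<lambda>(t, i). \<xi> t i) (Suc n, i) \<in> measurable (past n j) S"
    unfolding past_def by (rule measurable_sample[OF measurable_samples[OF assms(3)] i(2)])
  then have \<xi>: "\<xi> (Suc n) i \<in> measurable (past n j) S"
    by simp
  have "y (Suc n) \<in> measurable (past n j) (restrict_space borel X)"
    by (rule measurable_past_mono[OF _ assms(3,1)]) simp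
  from measurable_oracle_noise[OF oracle_measurable measurable_\<xi>[OF i(1)] unbiased[OF _ i(1)] this \<xi>]
  show ?thesis
    by (simp add: \<delta>_def[abs_def])
qed

lemma measurable_dw [measurable]: "dw \<in> borel_measurable borel"
  by (rule borel_measurable_continuous_onI[OF continuous_dw])

text \<open>By \<open>step\<close> each iterate is a measurable expression, through
  \<open>prox\<close>, in earlier iterates and errors. A completed batch is the start of the next
  step, so the induction moves from \<open>past n m\<close> to
  \<open>past (Suc n) 0\<close>.\<close>

lemma measurable_iterates:
  "z n \<in> borel_measurable (past n 0) \<and> x n \<in> borel_measurable (past n 0)"
  and measurable_y: "y (Suc n) \<in> measurable (past n 0) (restrict_space borel X)"
proof -
  have y_meas: "y (Suc n) \<in> measurable (past n 0) (restrict_space borel X)"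
    if "z n \<in> borel_measurable (past n 0) \<and> x n \<in> borel_measurable (past n 0)" for n
  proof (rule measurable_restrict_space2)
    have "(\<lambda>\<omega>. (1 - \<beta> n) *\<^sub>R x n \<omega> + \<beta> n *\<^sub>R z n \<omega>) \<in> borel_measurable (past n 0)"
      using that by (intro borel_measurable_add borel_measurable_scaleR) auto
    then show "y (Suc n) \<in> borel_measurable (past n 0)"
      by (subst measurable_cong[where g = "\<lambda>\<omega>. (1 - \<beta> n) *\<^sub>R x n \<omega> + \<beta> n *\<^sub>R z n \<omega>"]) (simp_all add: step(1))
  qed (auto simp: iterates_in_X)
  show iter: "z n \<in> borel_measurable (past n 0) \<and> x n \<in> borel_measurable (past n 0)" for n
  proof (induction n)
    case 0
    \<comment> \<open>\<open>past 0 0\<close> is the trivial sigma-algebra, so it matters that the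
      start is deterministic.\<close>
    have "h \<in> borel_measurable (past 0 0)" if "\<And>\<omega>. \<omega> \<in> space M \<Longrightarrow> h \<omega> = x0" for h
      by (subst measurable_cong[where g = "\<lambda>_. x0"]) (simp_all add: that)
    then show ?case by (simp add: start)
  next
    case (Suc n)
    have [measurable]: "(\<lambda>\<omega>. g (y (Suc n) \<omega>)) \<in> borel_measurable (past n m)"
    proof (rule measurable_compose[where f = "y (Suc n)" and g = g])
      show "y (Suc n) \<in> measurable (past n m) (restrict_space borel X)"
        by (rule measurable_past_mono[OF _ _ y_meas[OF Suc]]) simp_all
      have "1 \<in> {1..m}"
        using m_ge_1 by simp
      from measurable_oracle_mean[OF oracle_measurable measurable_\<xi>[OF this, of 0] unbiased[OF _ this]]
      show "g \<in> borel_measurable (restrict_space borel X)" .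
    qed
    have \<delta> [measurable]: "\<delta> n i \<in> borel_measurable (past n m)" if "i \<in> {1..m}" for i
      using measurable_\<delta>'[OF y_meas[OF Suc]] that by auto
    have [measurable]: "z n \<in> borel_measurable (past n m)" "x n \<in> borel_measurable (past n m)"
      using Suc by (auto intro: measurable_past_mono[of 0 m])
    have "(\<lambda>\<omega>. prox (dw (z n \<omega> - x0)
      - (1 / e n) *\<^sub>R (g (y (Suc n) \<omega>) + (1 / real m) *\<^sub>R (\<Sum>i=1..m. \<delta> n i \<omega>)))) \<in> borel_measurable (past n m)"
      by measurable
    then have [measurable]: "z (Suc n) \<in> borel_measurable (past n m)"
      by (subst measurable_cong) (auto simp: step(3))
    have "(\<lambda>\<omega>. (1 - \<beta> n) *\<^sub>R x n \<omega> + \<beta> n *\<^sub>R z (Suc n) \<omega>) \<in> borel_measurable (past n m)"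
      by measurable
    then have "x (Suc n) \<in> borel_measurable (past n m)"
      by (subst measurable_cong) (auto simp: step(2))
    with \<open>z (Suc n) \<in> _\<close> show ?case
      by (simp add: past_def samples_Suc)
  qed
  show "y (Suc n) \<in> measurable (past n 0) (restrict_space borel X)"
    by (rule y_meas[OF iter])
qed

lemma measurable_z [measurable]: "z n \<in> borel_measurable M"
  and measurable_x [measurable]: "x n \<in> borel_measurable M"
  using measurable_iterates[of n] by (auto intro: measurable_past[of 0])

lemma measurable_\<delta>: "i \<in> {1..j} \<Longrightarrow> j \<le> m \<Longrightarrow> \<delta> n i \<in> borel_measurable (past n j)"
  by (rule measurable_\<delta>'[OF measurable_y])

lemma measurable_\<delta>_M: "i \<in> {1..m} \<Longrightarrow> \<delta> n i \<in> borel_measurable M"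
  using measurable_\<delta>[of i m n] by (auto intro: measurable_past[of m])

lemma measurable_w [measurable]: "w \<in> borel_measurable borel"
  by (rule borel_measurable_continuous_onI[OF continuous_on_w])

lemma measurable_V [measurable]: "(\<lambda>\<omega>. V (z n \<omega>) xs) \<in> borel_measurable M"
  unfolding bregman_def by measurable

lemma measurable_f: "h \<in> borel_measurable M \<Longrightarrow> (\<And>\<omega>. \<omega> \<in> space M \<Longrightarrow> h \<omega> \<in> X) \<Longrightarrow>
    (\<lambda>\<omega>. f (h \<omega>)) \<in> borel_measurable M"
  by (rule measurable_compose[OF measurable_restrict_space2 borel_measurable_continuous_on_restrict[OF continuous_f]])
    auto

definition value_gap where "value_gap n \<omega> = f (x n \<omega>) - f xs"

lemma measurable_value_gap [measurable]: "value_gap n \<in> borel_measurable M"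
  unfolding value_gap_def[abs_def]
  by (intro borel_measurable_diff measurable_f borel_measurable_const) (auto simp: iterates_in_X)

lemma value_gap_nonneg: "\<omega> \<in> space M \<Longrightarrow> 0 \<le> value_gap n \<omega>"
  by (simp add: value_gap_def xs_min iterates_in_X)

lemma pathwise:
  assumes "\<omega> \<in> space M"
  shows "value_gap (Suc n) \<omega> + \<beta> n * e n * V (z (Suc n) \<omega>) xs
    \<le> (1 - \<beta> n) * value_gap n \<omega> + \<beta> n * e n * V (z n \<omega>) xs
      + \<beta> n * e n / 4 * (\<Sum>j=1..m. (K n)\<^sup>2 / 2 * (dual_norm N (\<delta> n j \<omega>))\<^sup>2
          - K n * (\<delta> n j \<omega> \<bullet> (prox (dual_pt n (j - 1) \<omega>) - z n \<omega>)))
      - \<beta> n / real m * (\<Sum>j=1..m. \<delta> n j \<omega> \<bullet> (z n \<omega> - xs))"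
  unfolding value_gap_def step(2)[OF assms] dual_pt_def K_def
  by (rule sagd_step[OF e_pos m_ge_1 _ _ \<beta>_bounds step_size]) (use assms in \<open>simp_all add: iterates_in_X step(1,3)\<close>)

lemma gap_y:
  "\<omega> \<in> space M \<Longrightarrow> gap (y (Suc n) \<omega>) \<le> (1 - \<beta> n) * value_gap n \<omega> + \<beta> n * (L * V (z n \<omega>) xs)"
  unfolding step(1) value_gap_def by (rule gap_convex_comb[OF convex_f]) (auto simp: iterates_in_X \<beta>_bounds)

text \<open>All inner products with the noise are martingale increments, since
  \<open>dual_pt n (j - 1)\<close> only involves the samples preceding the \<open>j\<close>-th one.\<close>

lemma expected_step:
  assumes int_gap: "integrable M (value_gap n)" and int_V: "integrable M (\<lambda>\<omega>. V (z n \<omega>) xs)"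
  shows "integrable M (value_gap (Suc n))" "integrable M (\<lambda>\<omega>. V (z (Suc n) \<omega>) xs)"
    "expectation (value_gap (Suc n)) + \<beta> n * e n * expectation (\<lambda>\<omega>. V (z (Suc n) \<omega>) xs)
      \<le> (1 - \<beta> n) * expectation (value_gap n) + \<beta> n * e n * expectation (\<lambda>\<omega>. V (z n \<omega>) xs)
        + 2 * \<beta> n / (real m * e n) * (\<L> * ((1 - \<beta> n) * expectation (value_gap n)
            + \<beta> n * (L * expectation (\<lambda>\<omega>. V (z n \<omega>) xs))) + \<sigma>\<^sup>2)"
proof -
  define Q where "Q = \<L> * ((1 - \<beta> n) * expectation (value_gap n)
      + \<beta> n * (L * expectation (\<lambda>\<omega>. V (z n \<omega>) xs))) + \<sigma>\<^sup>2"
  have y_M: "y (Suc n) \<in> measurable M (restrict_space borel X)"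
    by (rule measurable_past[OF _ measurable_y]) simp
  have gap_meas: "(\<lambda>\<omega>. gap (y (Suc n) \<omega>)) \<in> borel_measurable M"
  proof -
    have [measurable]: "y (Suc n) \<in> borel_measurable M"
      using measurable_compose[OF y_M measurable_restrict_space1[OF measurable_ident]] by simp
    have [measurable]: "(\<lambda>\<omega>. f (y (Suc n) \<omega>)) \<in> borel_measurable M"
      by (rule measurable_f) (auto simp: iterates_in_X)
    show ?thesis
      unfolding gap_def by measurable
  qed
  have int_bound: "integrable M (\<lambda>\<omega>. (1 - \<beta> n) * value_gap n \<omega> + \<beta> n * (L * V (z n \<omega>) xs))"
    using int_gap int_V by simp
  have int_gap_y: "integrable M (\<lambda>\<omega>. gap (y (Suc n) \<omega>))"
  proof (rule Bochner_Integration.integrable_bound[OF int_bound gap_meas])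
    show "AE \<omega> in M. norm (gap (y (Suc n) \<omega>))
        \<le> norm ((1 - \<beta> n) * value_gap n \<omega> + \<beta> n * (L * V (z n \<omega>) xs))"
    proof (rule AE_I2)
      fix \<omega> assume "\<omega> \<in> space M"
      then show "norm (gap (y (Suc n) \<omega>))
          \<le> norm ((1 - \<beta> n) * value_gap n \<omega> + \<beta> n * (L * V (z n \<omega>) xs))"
        using gap_y[of \<omega> n] gap_nonneg[of "y (Suc n) \<omega>"] by (simp add: iterates_in_X)
    qed
  qed
  have "expectation (\<lambda>\<omega>. gap (y (Suc n) \<omega>))
      \<le> expectation (\<lambda>\<omega>. (1 - \<beta> n) * value_gap n \<omega> + \<beta> n * (L * V (z n \<omega>) xs))"
    by (rule integral_mono[OF int_gap_y int_bound gap_y])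
  also have "\<dots> = (1 - \<beta> n) * expectation (value_gap n) + \<beta> n * (L * expectation (\<lambda>\<omega>. V (z n \<omega>) xs))"
    using int_gap int_V by simp
  finally have gap_le: "\<L> * expectation (\<lambda>\<omega>. gap (y (Suc n) \<omega>)) + \<sigma>\<^sup>2 \<le> Q"
    unfolding Q_def using \<L>_nonneg by (simp add: mult_left_mono)

  have noise: "integrable M (\<lambda>\<omega>. (dual_norm N (\<delta> n j \<omega>))\<^sup>2)"
    "expectation (\<lambda>\<omega>. (dual_norm N (\<delta> n j \<omega>))\<^sup>2) \<le> Q" if j: "j \<in> {1..m}" for j
  proof -
    have y: "y (Suc n) \<in> measurable (past n (j - 1)) (restrict_space borel X)"
      using j by (intro measurable_past_mono[of 0, OF _ _ measurable_y]) auto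
    have int: "integrable M (\<lambda>\<omega>. \<L> * gap (y (Suc n) \<omega>) + \<sigma>\<^sup>2)"
      using int_gap_y by simp
    have "(\<lambda>v. (dual_norm N v)\<^sup>2) \<in> borel_measurable borel"
      by measurable
    note var = oracle_noise_variance[OF oracle_measurable measurable_\<xi>[OF j] unbiased[OF _ j] indep_past[OF j] y this,
        of "\<lambda>v. \<L> * gap v + \<sigma>\<^sup>2"]
    show "integrable M (\<lambda>\<omega>. (dual_norm N (\<delta> n j \<omega>))\<^sup>2)"
      unfolding \<delta>_def by (rule var(1)) (use variance j int in auto)
    have "expectation (\<lambda>\<omega>. (dual_norm N (\<delta> n j \<omega>))\<^sup>2) \<le> expectation (\<lambda>\<omega>. \<L> * gap (y (Suc n) \<omega>) + \<sigma>\<^sup>2)"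
      unfolding \<delta>_def by (rule var(2)) (use variance j int in auto)
    also have "\<dots> \<le> Q"
      using int_gap_y gap_le by (simp add: prob_space)
    finally show "expectation (\<lambda>\<omega>. (dual_norm N (\<delta> n j \<omega>))\<^sup>2) \<le> Q" .
  qed
  \<comment> \<open>The passage to Euclidean second moments serves the Cauchy-Schwarz argument for
    integrability of the inner products with the noise.\<close>
  have \<delta>_sq: "integrable M (\<lambda>\<omega>. (norm (\<delta> n j \<omega>))\<^sup>2)" if j: "j \<in> {1..m}" for j
  proof -
    obtain C where C: "0 < C" "\<And>z. norm z \<le> C * dual_norm N z"
      using norm_le_dual_norm by blast
    note [measurable] = measurable_\<delta>_M[OF j]
    have le: "(norm v)\<^sup>2 \<le> C\<^sup>2 * (dual_norm N v)\<^sup>2" for v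
      using power_mono[OF C(2)[of v], of 2] by (simp add: power_mult_distrib)
    show ?thesis
      by (rule Bochner_Integration.integrable_bound[of M "\<lambda>\<omega>. C\<^sup>2 * (dual_norm N (\<delta> n j \<omega>))\<^sup>2"])
        (use noise(1)[OF j] le in auto)
  qed
  have mean_zero: "integrable M (\<lambda>\<omega>. \<delta> n j \<omega> \<bullet> a \<omega>) \<and> expectation (\<lambda>\<omega>. \<delta> n j \<omega> \<bullet> a \<omega>) = 0"
    if j: "j \<in> {1..m}" and a: "a \<in> borel_measurable (past n (j - 1))"
      and a_sq: "integrable M (\<lambda>\<omega>. (norm (a \<omega>))\<^sup>2)" for j a
  proof
    have "a \<in> borel_measurable M"
      using j by (intro measurable_past[OF _ a]) auto
    then show int: "integrable M (\<lambda>\<omega>. \<delta> n j \<omega> \<bullet> a \<omega>)"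
      by (rule integrable_inner_of_norm_sq[OF measurable_\<delta>_M[OF j] _ \<delta>_sq[OF j] a_sq])
    have y: "y (Suc n) \<in> measurable (past n (j - 1)) (restrict_space borel X)"
      using j by (intro measurable_past_mono[of 0, OF _ _ measurable_y]) auto
    show "expectation (\<lambda>\<omega>. \<delta> n j \<omega> \<bullet> a \<omega>) = 0"
      unfolding \<delta>_def
      by (rule oracle_noise_mean_zero[OF oracle_measurable measurable_\<xi>[OF j] unbiased[OF _ j] indep_past[OF j] y a])
        (use int in \<open>simp_all add: \<delta>_def\<close>)
  qed
  have z_past: "z n \<in> borel_measurable (past n (j - 1))" if "j \<in> {1..m}" for j
    using that measurable_iterates[of n] by (intro measurable_past_mono[of 0 "j - 1"]) auto
  have prox_mart: "integrable M (\<lambda>\<omega>. \<delta> n j \<omega> \<bullet> (prox (dual_pt n (j - 1) \<omega>) - z n \<omega>)) \<and>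
      expectation (\<lambda>\<omega>. \<delta> n j \<omega> \<bullet> (prox (dual_pt n (j - 1) \<omega>) - z n \<omega>)) = 0" if j: "j \<in> {1..m}" for j
  proof (rule mean_zero[OF j])
    note [measurable] = z_past[OF j]
    have \<delta>_past [measurable]: "\<delta> n i \<in> borel_measurable (past n (j - 1))" if "i \<in> {1..j - 1}" for i
      using measurable_\<delta>[OF that] j by auto
    have "dual_pt n (j - 1) \<in> borel_measurable (past n (j - 1))"
      unfolding dual_pt_def[abs_def] by measurable
    then show meas: "(\<lambda>\<omega>. prox (dual_pt n (j - 1) \<omega>) - z n \<omega>) \<in> borel_measurable (past n (j - 1))"
      by measurable
    obtain C where C: "0 < C" "\<And>s s'. norm (prox s - prox s') \<le> C * norm (s - s')"
      using prox_norm_lipschitz by blast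
    have "integrable M (\<lambda>\<omega>. (norm (\<Sum>i=1..j - 1. - K n *\<^sub>R \<delta> n i \<omega>))\<^sup>2)"
    proof (rule integrable_norm_sq_sum)
      fix i assume "i \<in> {1..j - 1}"
      then have i: "i \<in> {1..m}" using j by auto
      show "(\<lambda>\<omega>. - K n *\<^sub>R \<delta> n i \<omega>) \<in> borel_measurable M"
        using measurable_\<delta>_M[OF i] by measurable
      show "integrable M (\<lambda>\<omega>. (norm (- K n *\<^sub>R \<delta> n i \<omega>))\<^sup>2)"
        using \<delta>_sq[OF i] by (simp add: power_mult_distrib)
    qed simp
    then have int: "integrable M (\<lambda>\<omega>. C\<^sup>2 * (norm (\<Sum>i=1..j - 1. - K n *\<^sub>R \<delta> n i \<omega>))\<^sup>2)"
      by simp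
    \<comment> \<open>\<open>z n\<close> is itself the prox point of the unperturbed dual vector, so
      by the Lipschitz property its distance to the perturbed one is controlled by the errors
      alone.\<close>
    have le: "(norm (prox (dual_pt n (j - 1) \<omega>) - z n \<omega>))\<^sup>2
        \<le> C\<^sup>2 * (norm (\<Sum>i=1..j - 1. - K n *\<^sub>R \<delta> n i \<omega>))\<^sup>2" if "\<omega> \<in> space M" for \<omega>
    proof -
      have "norm (prox (dual_pt n (j - 1) \<omega>) - prox (dw (z n \<omega> - x0)))
          \<le> C * norm (\<Sum>i=1..j - 1. - K n *\<^sub>R \<delta> n i \<omega>)"
        using C(2)[of "dual_pt n (j - 1) \<omega>" "dw (z n \<omega> - x0)"] by (simp add: dual_pt_def)
      then show ?thesis
        unfolding prox_dw[OF iterates_in_X(1)[OF that]] power_mult_distrib[symmetric]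
        by (rule power_mono) simp
    qed
    have "(\<lambda>\<omega>. prox (dual_pt n (j - 1) \<omega>) - z n \<omega>) \<in> borel_measurable M"
      using j by (intro measurable_past[OF _ meas]) auto
    then show "integrable M (\<lambda>\<omega>. (norm (prox (dual_pt n (j - 1) \<omega>) - z n \<omega>))\<^sup>2)"
      by (intro Bochner_Integration.integrable_bound[OF int]) (use le in auto)
  qed
  have z_mart: "integrable M (\<lambda>\<omega>. \<delta> n j \<omega> \<bullet> (z n \<omega> - xs)) \<and>
      expectation (\<lambda>\<omega>. \<delta> n j \<omega> \<bullet> (z n \<omega> - xs)) = 0" if j: "j \<in> {1..m}" for j
  proof (rule mean_zero[OF j])
    show "(\<lambda>\<omega>. z n \<omega> - xs) \<in> borel_measurable (past n (j - 1))"
      using z_past[OF j] by simp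
    obtain c where c: "0 < c" "\<And>x. norm x \<le> c * N x"
      using norm_le_N by blast
    \<comment> \<open>Strong convexity of \<open>w\<close> turns integrability of the divergence
      into a second moment of \<open>z n\<close>.\<close>
    have le: "(norm (z n \<omega> - xs))\<^sup>2 \<le> 2 * c\<^sup>2 * V (z n \<omega>) xs" for \<omega>
    proof -
      have "(norm (z n \<omega> - xs))\<^sup>2 \<le> c\<^sup>2 * (N (xs - z n \<omega>))\<^sup>2"
        using power_mono[OF c(2)[of "z n \<omega> - xs"], of 2] by (simp add: power_mult_distrib N_minus_commute[of xs])
      also have "\<dots> \<le> c\<^sup>2 * (2 * V (z n \<omega>) xs)"
        using V_lower_bound[of xs "z n \<omega>"] by (intro mult_left_mono) auto
      finally show ?thesis by simp
    qed
    show "integrable M (\<lambda>\<omega>. (norm (z n \<omega> - xs))\<^sup>2)"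
      by (rule Bochner_Integration.integrable_bound[of M "\<lambda>\<omega>. 2 * c\<^sup>2 * V (z n \<omega>) xs"])
        (use int_V le V_nonneg in auto)
  qed

  define R where "R \<omega> = (1 - \<beta> n) * value_gap n \<omega> + \<beta> n * e n * V (z n \<omega>) xs
      + \<beta> n * e n / 4 * (\<Sum>j=1..m. (K n)\<^sup>2 / 2 * (dual_norm N (\<delta> n j \<omega>))\<^sup>2
          - K n * (\<delta> n j \<omega> \<bullet> (prox (dual_pt n (j - 1) \<omega>) - z n \<omega>)))
      - \<beta> n / real m * (\<Sum>j=1..m. \<delta> n j \<omega> \<bullet> (z n \<omega> - xs))" for \<omega>
  have prox_sum: "has_bochner_integral M
      (\<lambda>\<omega>. \<Sum>j=1..m. (K n)\<^sup>2 / 2 * (dual_norm N (\<delta> n j \<omega>))\<^sup>2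
          - K n * (\<delta> n j \<omega> \<bullet> (prox (dual_pt n (j - 1) \<omega>) - z n \<omega>)))
      (\<Sum>j=1..m. (K n)\<^sup>2 / 2 * expectation (\<lambda>\<omega>. (dual_norm N (\<delta> n j \<omega>))\<^sup>2) - K n * 0)"
  proof (rule has_bochner_integral_sum)
    fix j assume j: "j \<in> {1..m}"
    show "has_bochner_integral M (\<lambda>\<omega>. (K n)\<^sup>2 / 2 * (dual_norm N (\<delta> n j \<omega>))\<^sup>2
          - K n * (\<delta> n j \<omega> \<bullet> (prox (dual_pt n (j - 1) \<omega>) - z n \<omega>)))
        ((K n)\<^sup>2 / 2 * expectation (\<lambda>\<omega>. (dual_norm N (\<delta> n j \<omega>))\<^sup>2) - K n * 0)"
    proof (intro has_bochner_integral_diff has_bochner_integral_mult_right)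
      show "has_bochner_integral M (\<lambda>\<omega>. (dual_norm N (\<delta> n j \<omega>))\<^sup>2)
          (expectation (\<lambda>\<omega>. (dual_norm N (\<delta> n j \<omega>))\<^sup>2))"
        using noise(1)[OF j] by (rule has_bochner_integral_integrable)
      show "has_bochner_integral M (\<lambda>\<omega>. \<delta> n j \<omega> \<bullet> (prox (dual_pt n (j - 1) \<omega>) - z n \<omega>)) 0"
        using prox_mart[OF j] unfolding has_bochner_integral_iff .
    qed
  qed
  have z_sum: "has_bochner_integral M (\<lambda>\<omega>. \<Sum>j=1..m. \<delta> n j \<omega> \<bullet> (z n \<omega> - xs)) (\<Sum>j=1..m. 0)"
    by (rule has_bochner_integral_sum) (use z_mart in \<open>simp only: has_bochner_integral_iff\<close>)
  have R_integral: "has_bochner_integral M R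
      ((1 - \<beta> n) * expectation (value_gap n) + \<beta> n * e n * expectation (\<lambda>\<omega>. V (z n \<omega>) xs)
        + \<beta> n * e n / 4 * (\<Sum>j=1..m. (K n)\<^sup>2 / 2 * expectation (\<lambda>\<omega>. (dual_norm N (\<delta> n j \<omega>))\<^sup>2) - K n * 0)
        - \<beta> n / real m * (\<Sum>j=1..m. 0))"
    unfolding R_def[abs_def]
    by (intro has_bochner_integral_diff has_bochner_integral_add has_bochner_integral_mult_right
          prox_sum z_sum has_bochner_integral_integrable int_gap int_V)
  then have int_R: "integrable M R"
    by (simp only: has_bochner_integral_iff)
  have \<beta>e: "0 < \<beta> n * e n"
    by (simp add: \<beta>_pos e_pos)
  have R: "value_gap (Suc n) \<omega> + \<beta> n * e n * V (z (Suc n) \<omega>) xs \<le> R \<omega>" if "\<omega> \<in> space M" for \<omega>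
    unfolding R_def by (rule pathwise[OF that])
  \<comment> \<open>Both summands on the left of the pathwise inequality are nonnegative, so each is
    dominated by the integrable \<open>R\<close>; this is how integrability reaches the next
    step.\<close>
  have V_part: "0 \<le> \<beta> n * e n * V (z (Suc n) \<omega>) xs" for \<omega>
    using \<beta>e V_nonneg[of "z (Suc n) \<omega>" xs] by (simp add: less_imp_le)
  show int_gap': "integrable M (value_gap (Suc n))"
  proof (rule Bochner_Integration.integrable_bound[OF int_R])
    show "AE \<omega> in M. norm (value_gap (Suc n) \<omega>) \<le> norm (R \<omega>)"
    proof (rule AE_I2)
      fix \<omega> assume "\<omega> \<in> space M"
      then show "norm (value_gap (Suc n) \<omega>) \<le> norm (R \<omega>)"
        using R[of \<omega>] V_part[of \<omega>] value_gap_nonneg[of \<omega> "Suc n"] unfolding real_norm_def by linarith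
    qed
  qed measurable
  have "integrable M (\<lambda>\<omega>. \<beta> n * e n * V (z (Suc n) \<omega>) xs)"
  proof (rule Bochner_Integration.integrable_bound[OF int_R])
    show "AE \<omega> in M. norm (\<beta> n * e n * V (z (Suc n) \<omega>) xs) \<le> norm (R \<omega>)"
    proof (rule AE_I2)
      fix \<omega> assume "\<omega> \<in> space M"
      then show "norm (\<beta> n * e n * V (z (Suc n) \<omega>) xs) \<le> norm (R \<omega>)"
        using R[of \<omega>] V_part[of \<omega>] value_gap_nonneg[of \<omega> "Suc n"] unfolding real_norm_def by linarith
    qed
  qed measurable
  then show int_V': "integrable M (\<lambda>\<omega>. V (z (Suc n) \<omega>) xs)"
    using \<beta>e by auto
  have "expectation (value_gap (Suc n)) + \<beta> n * e n * expectation (\<lambda>\<omega>. V (z (Suc n) \<omega>) xs)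
      = expectation (\<lambda>\<omega>. value_gap (Suc n) \<omega> + \<beta> n * e n * V (z (Suc n) \<omega>) xs)"
    using int_gap' int_V' by simp
  also have "\<dots> \<le> expectation R"
    using int_gap' int_V' int_R R by (intro integral_mono) auto
  also have "expectation R = (1 - \<beta> n) * expectation (value_gap n) + \<beta> n * e n * expectation (\<lambda>\<omega>. V (z n \<omega>) xs)
      + \<beta> n * e n / 4 * (\<Sum>j=1..m. (K n)\<^sup>2 / 2 * expectation (\<lambda>\<omega>. (dual_norm N (\<delta> n j \<omega>))\<^sup>2))"
    using R_integral by (simp add: has_bochner_integral_iff)
  also have "\<dots> \<le> (1 - \<beta> n) * expectation (value_gap n) + \<beta> n * e n * expectation (\<lambda>\<omega>. V (z n \<omega>) xs)
      + \<beta> n * e n / 4 * (\<Sum>j=1..m. (K n)\<^sup>2 / 2 * Q)"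
    using noise(2) \<beta>e by (intro add_left_mono mult_left_mono sum_mono) auto
  \<comment> \<open>Since \<open>K n\<close> contains \<open>1 / real m\<close>, its square against
    the \<open>m\<close> summands leaves the factor \<open>1 / real m\<close> of the variance
    reduction.\<close>
  also have "\<beta> n * e n / 4 * (\<Sum>j=1..m. (K n)\<^sup>2 / 2 * Q) = 2 * \<beta> n / (real m * e n) * Q"
    using m_ge_1 e_pos[of n] by (simp add: K_def field_simps power2_eq_square)
  finally show "expectation (value_gap (Suc n)) + \<beta> n * e n * expectation (\<lambda>\<omega>. V (z (Suc n) \<omega>) xs)
      \<le> (1 - \<beta> n) * expectation (value_gap n) + \<beta> n * e n * expectation (\<lambda>\<omega>. V (z n \<omega>) xs)
        + 2 * \<beta> n / (real m * e n) * (\<L> * ((1 - \<beta> n) * expectation (value_gap n)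
            + \<beta> n * (L * expectation (\<lambda>\<omega>. V (z n \<omega>) xs))) + \<sigma>\<^sup>2)"
    unfolding Q_def .
qed

lemma integrable_iterates: "integrable M (value_gap n) \<and> integrable M (\<lambda>\<omega>. V (z n \<omega>) xs)"
proof (induction n)
  case 0
  have "integrable M h" if "\<And>\<omega>. \<omega> \<in> space M \<Longrightarrow> h \<omega> = b" for h and b :: real
    by (subst Bochner_Integration.integrable_cong[where g = "\<lambda>_. b", OF refl]) (simp_all add: that)
  then show ?case
    by (simp add: start value_gap_def)
qed (use expected_step in auto)

text \<open>\<open>a\<close> and \<open>c\<close> stay free so that they can be taken as the squared
  ratios of the third and fourth term of the maximum to \<open>\<eta>\<close>. The first claim uses
  only that they are at most 1, the second needs their size.\<close>

lemma rates:
  fixes D a c :: real and k :: nat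
  assumes "V x0 xs \<le> D\<^sup>2" and a: "0 \<le> a" "a \<le> 1" and c: "0 \<le> c" "c \<le> 1"
    and \<eta>1: "6 * (real k - 1) * \<L> / real m \<le> \<eta>"
    and \<eta>2: "9 * (real k + 1)\<^sup>2 * L * \<L> / real m \<le> a * \<eta>\<^sup>2"
    and \<eta>3: "\<sigma>\<^sup>2 * (2 * (real k + 2) ^ 3 / (3 * real m)) \<le> c * D\<^sup>2 * \<eta>\<^sup>2"
  shows "t \<le> k \<Longrightarrow> expectation (\<lambda>\<omega>. V (z t \<omega>) xs) \<le> 3 * D\<^sup>2"
    and "1 \<le> k \<Longrightarrow> expectation (value_gap k)
      \<le> 3 * \<eta> * (D\<^sup>2 * (1 + a + c)) / ((real k + 1) * (real k + 2))"
proof -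
  let ?d = "\<lambda>n. expectation (value_gap n)" and ?v = "\<lambda>n. expectation (\<lambda>\<omega>. V (z n \<omega>) xs)"
  have d_nonneg: "0 \<le> ?d n" for n
    by (rule Bochner_Integration.integral_nonneg_AE) (rule AE_I2[OF value_gap_nonneg])
  have v_nonneg: "0 \<le> ?v n" for n
    by (rule Bochner_Integration.integral_nonneg) (rule V_nonneg)
  have "?v 0 = expectation (\<lambda>_. V x0 xs)"
    by (rule Bochner_Integration.integral_cong) (simp_all add: start)
  then have v0: "?v 0 \<le> D\<^sup>2"
    using assms(1) by (simp add: prob_space)
  define U where "U t = D\<^sup>2 * (1 + a * ((real t * (real t + 1) + 2 * real t / 3) / (real k + 1)\<^sup>2)
      + c * ((real t + 2) ^ 3 / (real k + 2) ^ 3))" for t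
  have rec: "real t * (real t + 1) * (real t + 2) * ?d t \<le> 3 * \<eta> * real t * (U t - ?v t)
      \<and> ?v t \<le> U t \<and> U t \<le> D\<^sup>2 * (1 + a + c)" if "t \<le> k" for t
    unfolding U_def
  proof (rule sagd_recursion[where d = ?d and v = ?v, OF d_nonneg v_nonneg v0 \<eta>(1) _ \<L>_nonneg a c \<eta>1 \<eta>2 \<eta>3 _ that])
    show "0 < real m"
      using m_ge_1 by simp
    fix n and b s :: real
    assume "b = 3 / (real n + 3)" "s = \<eta> / (real n + 2)"
    then have "b = \<beta> n" "s = e n"
      by (simp_all add: \<beta>_def e_def)
    then show "?d (Suc n) + b * s * ?v (Suc n) \<le> (1 - b) * ?d n + b * s * ?v n
        + 2 * b / (real m * s) * (\<L> * ((1 - b) * ?d n + b * (L * ?v n)) + \<sigma>\<^sup>2)"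
      using expected_step(3) integrable_iterates[of n] by simp
  qed
  have "D\<^sup>2 * (1 + a + c) \<le> D\<^sup>2 * 3"
    using a c by (intro mult_left_mono) auto
  then show "expectation (\<lambda>\<omega>. V (z t \<omega>) xs) \<le> 3 * D\<^sup>2" if "t \<le> k"
    using rec[OF that] by linarith
  show "expectation (value_gap k) \<le> 3 * \<eta> * (D\<^sup>2 * (1 + a + c)) / ((real k + 1) * (real k + 2))" if "1 \<le> k"
  proof -
    have "real k * (real k + 1) * (real k + 2) * ?d k \<le> 3 * \<eta> * real k * (U k - ?v k)"
      using rec by simp
    also have "\<dots> \<le> 3 * \<eta> * real k * (D\<^sup>2 * (1 + a + c))"
      using rec[of k] v_nonneg[of k] \<eta> by (intro mult_left_mono) auto
    finally have "real k * ((real k + 1) * (real k + 2) * ?d k) \<le> real k * (3 * \<eta> * (D\<^sup>2 * (1 + a + c)))"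
      by (simp add: mult_ac)
    then have "(real k + 1) * (real k + 2) * ?d k \<le> 3 * \<eta> * (D\<^sup>2 * (1 + a + c))"
      using that by simp
    then show ?thesis
      by (simp add: pos_le_divide_eq mult_ac)
  qed
qed

end

text \<open>Integrability belongs to the conclusion, because the integral of a nonintegrable
  function is 0 by convention and the bounds would say nothing. The maximum vanishes when
  \<open>L\<close>, \<open>\<L>\<close> and \<open>\<sigma>\<close> are all 0;
  \<open>0 < \<eta>\<close> is the admissibility of the step sizes.\<close>

theorem corollary1:
  fixes N :: "'a::euclidean_space \<Rightarrow> real"
    and X :: "'a set" and f :: "'a \<Rightarrow> real" and g :: "'a \<Rightarrow> 'a" and L :: real
    and w :: "'a \<Rightarrow> real" and dw :: "'a \<Rightarrow> 'a"
    and M :: "'w measure" and \<Xi> :: "'s measure"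
    and \<xi> :: "nat \<Rightarrow> nat \<Rightarrow> 'w \<Rightarrow> 's" and Or :: "'a \<Rightarrow> 's \<Rightarrow> 'a"
    and \<L> \<sigma> D \<eta> :: real and k m :: nat and x0 xstar :: 'a
    and z y x :: "nat \<Rightarrow> 'w \<Rightarrow> 'a"
  defines "V \<equiv> bregman w dw x0"
    and "fstar \<equiv> (INF v\<in>X. f v)"
  assumes "norm_fun N"
    and "closed X" and "convex X"
    and "convex_on X f" and "gradient_on X f g"
    and "0 \<le> L"
    and "\<And>u v. u \<in> X \<Longrightarrow> v \<in> X \<Longrightarrow>
           0 \<le> f v - f u - g u \<bullet> (v - u) \<and> f v - f u - g u \<bullet> (v - u) \<le> L / 2 * (N (v - u))\<^sup>2"
    and "xstar \<in> minimizers X f"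
    and "gradient_on UNIV w dw" and "continuous_on UNIV dw"
    and "strongly_convex N 1 w"
    and "w 0 = 0" and "\<And>v. w 0 \<le> w v"
    and "prob_space M"
    and "(\<lambda>(v, s). Or v s) \<in> borel_measurable (restrict_space borel X \<Otimes>\<^sub>M \<Xi>)"
    and "1 \<le> m"
    and "prob_space.indep_vars M (\<lambda>_. \<Xi>) (\<lambda>(t, i). \<xi> t i) (UNIV \<times> {1..m})"
    and "\<And>t i. i \<in> {1..m} \<Longrightarrow> distr M \<Xi> (\<xi> t i) = distr M \<Xi> (\<xi> t 1)"
    and "\<And>v t i. v \<in> X \<Longrightarrow> i \<in> {1..m} \<Longrightarrow>
           has_bochner_integral M (\<lambda>\<omega>. Or v (\<xi> t i \<omega>)) (g v)"
    and "0 \<le> \<L>" and "0 \<le> \<sigma>"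
    and "\<And>v t. v \<in> X \<Longrightarrow>
           integrable M (\<lambda>\<omega>. (dual_norm N (Or v (\<xi> t 1 \<omega>) - g v))\<^sup>2) \<and>
           (\<integral>\<omega>. (dual_norm N (Or v (\<xi> t 1 \<omega>) - g v))\<^sup>2 \<partial>M)
             \<le> \<L> * (f v - fstar - g xstar \<bullet> (v - xstar)) + \<sigma>\<^sup>2"
    and "2 \<le> k" and "0 < D"
    and "x0 \<in> X" and "V x0 xstar \<le> D\<^sup>2"
    and "\<eta> = Max {4 * L, 6 * (real k - 1) * \<L> / real m,
                  sqrt (9 * (real k + 1)\<^sup>2 * L * \<L> / real m),
                  \<sigma> / D * sqrt (2 * (real k + 2) ^ 3 / (3 * real m))}"
    and "0 < \<eta>"
    and "\<And>\<omega>. \<omega> \<in> space M \<Longrightarrow>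
           sagd X V Or (\<lambda>t. 3 / (real t + 2)) (\<lambda>t. \<eta> / (real t + 1)) (\<lambda>_. m) x0
             (\<lambda>t i. \<xi> t i \<omega>) (\<lambda>t. z t \<omega>) (\<lambda>t. y t \<omega>) (\<lambda>t. x t \<omega>)"
  shows "(\<forall>t\<in>{1..k}. integrable M (\<lambda>\<omega>. V (z t \<omega>) xstar) \<and>
            (\<integral>\<omega>. V (z t \<omega>) xstar \<partial>M) \<le> 3 * D\<^sup>2) \<and>
         integrable M (\<lambda>\<omega>. f (x k \<omega>) - fstar) \<and>
         (\<integral>\<omega>. f (x k \<omega>) - fstar \<partial>M)
           \<le> 12 * L * D\<^sup>2 / ((real k + 1) * (real k + 2))
             + 18 * \<L> * D\<^sup>2 / ((real k + 2) * real m)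
             + 18 * D\<^sup>2 * sqrt (L * \<L>) / ((real k + 1) * sqrt (real m))
             + 4 * \<sigma> * D * sqrt 2 / sqrt ((real k + 1) * real m)"
proof -
  interpret prob_space M
    by fact
  have xs_min: "f xstar \<le> f v" if "v \<in> X" for v
    using \<open>xstar \<in> minimizers X f\<close> that by (auto simp: minimizers_def is_arg_min_def not_less)
  have xs_in: "xstar \<in> X"
    using \<open>xstar \<in> minimizers X f\<close> by (auto simp: minimizers_def is_arg_min_def)
  have fstar: "fstar = f xstar"
    unfolding fstar_def using xs_in xs_min by (intro cInf_eq_minimum) auto
  have continuous_f: "continuous_on X f"
    using \<open>gradient_on X f g\<close> unfolding gradient_on_def by (meson has_derivative_continuous_on)
  interpret smooth_objective N X w dw x0 f g L xstar
  proof unfold_locales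
    fix u v assume "u \<in> X" "v \<in> X"
    from assms(9)[OF this]
    show "f u + g u \<bullet> (v - u) \<le> f v" "f v \<le> f u + g u \<bullet> (v - u) + L / 2 * (N (v - u))\<^sup>2"
      by linarith+
  qed (fact assms xs_in | erule xs_min)+
  have gap_eq: "gap v = f v - fstar - g xstar \<bullet> (v - xstar)" for v
    by (simp add: gap_def fstar)
  have \<xi>: "\<xi> t i \<in> measurable M \<Xi>" if "i \<in> {1..m}" for t i
  proof -
    have "(\<lambda>(t, i). \<xi> t i) (t, i) \<in> measurable M \<Xi>"
      using \<open>indep_vars (\<lambda>_. \<Xi>) (\<lambda>(t, i). \<xi> t i) (UNIV \<times> {1..m})\<close> that
      unfolding indep_vars_def by (metis UNIV_I mem_Sigma_iff)
    then show ?thesis by simp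
  qed
  have one: "1 \<in> {1..m}"
    using \<open>1 \<le> m\<close> by simp
  \<comment> \<open>The variance hypothesis concerns the first sample of each batch; equality of the
    laws within a batch extends it to the others.\<close>
  have transfer: "integrable M (\<lambda>\<omega>. (dual_norm N (Or v (\<xi> t i \<omega>) - g v))\<^sup>2)
      \<and> (\<integral>\<omega>. (dual_norm N (Or v (\<xi> t i \<omega>) - g v))\<^sup>2 \<partial>M) \<le> \<L> * gap v + \<sigma>\<^sup>2"
    if v: "v \<in> X" and i: "i \<in> {1..m}" for v t i
  proof -
    let ?\<phi> = "\<lambda>s. (dual_norm N (Or v s - g v))\<^sup>2"
    have [measurable]: "Or v \<in> borel_measurable \<Xi>"
      by (rule measurable_oracle_at[OF assms(17) \<xi>[OF one, of 0] assms(21)[OF _ one] v])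
    have \<phi>: "?\<phi> \<in> borel_measurable \<Xi>"
      by measurable
    note same = assms(20)[OF i, of t]
    have "integrable M (\<lambda>\<omega>. ?\<phi> (\<xi> t i \<omega>)) \<longleftrightarrow> integrable M (\<lambda>\<omega>. ?\<phi> (\<xi> t 1 \<omega>))"
      using integrable_distr_eq[OF \<xi>[OF i] \<phi>, of t] integrable_distr_eq[OF \<xi>[OF one] \<phi>, of t]
      unfolding same by simp
    moreover have "(\<integral>\<omega>. ?\<phi> (\<xi> t i \<omega>) \<partial>M) = (\<integral>\<omega>. ?\<phi> (\<xi> t 1 \<omega>) \<partial>M)"
      using integral_distr[OF \<xi>[OF i] \<phi>, of t] integral_distr[OF \<xi>[OF one] \<phi>, of t]
      unfolding same by simp
    ultimately show ?thesis
      unfolding gap_eq using assms(24)[OF v, of t] by simp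
  qed
  define h1 where "h1 = 4 * L"
  define h2 where "h2 = 6 * (real k - 1) * \<L> / real m"
  define h3 where "h3 = sqrt (9 * (real k + 1)\<^sup>2 * L * \<L> / real m)"
  define h4 where "h4 = \<sigma> / D * sqrt (2 * (real k + 2) ^ 3 / (3 * real m))"
  have \<eta>_Max: "\<eta> = Max {h1, h2, h3, h4}"
    unfolding h1_def h2_def h3_def h4_def by fact
  then have h_le: "h1 \<le> \<eta>" "h2 \<le> \<eta>" "h3 \<le> \<eta>" "h4 \<le> \<eta>"
    by (auto intro: Max_ge)
  have h_nonneg: "0 \<le> h3" "0 \<le> h4"
    using \<open>0 \<le> L\<close> \<open>0 \<le> \<L>\<close> \<open>0 \<le> \<sigma>\<close> \<open>0 < D\<close> by (simp_all add: h3_def h4_def)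
  interpret sagd_process N X w dw x0 f g L xstar M \<Xi> \<xi> Or \<L> \<sigma> \<eta> m z y x
  proof unfold_locales
    show "4 * L \<le> \<eta>"
      using h_le(1) by (simp add: h1_def)
    show "sagd X (bregman w dw x0) Or (\<lambda>t. 3 / (real t + 2)) (\<lambda>t. \<eta> / (real t + 1)) (\<lambda>_. m) x0
        (\<lambda>t i. \<xi> t i \<omega>) (\<lambda>t. z t \<omega>) (\<lambda>t. y t \<omega>) (\<lambda>t. x t \<omega>)" if "\<omega> \<in> space M" for \<omega>
      using assms(31)[OF that] unfolding V_def .
  qed (fact assms continuous_f | erule assms, assumption | (drule (1) transfer, blast))+
  have "real m > 0"
    using \<open>1 \<le> m\<close> by simp
  have sq_le_1: "(h / \<eta>)\<^sup>2 \<le> 1" if "0 \<le> h" "h \<le> \<eta>" for h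
    using that \<open>0 < \<eta>\<close> by (simp add: power_le_one)
  have \<eta>2: "9 * (real k + 1)\<^sup>2 * L * \<L> / real m \<le> (h3 / \<eta>)\<^sup>2 * \<eta>\<^sup>2"
    using \<open>0 < \<eta>\<close> \<open>0 \<le> L\<close> \<open>0 \<le> \<L>\<close> by (simp add: power_divide h3_def)
  have \<eta>3: "\<sigma>\<^sup>2 * (2 * (real k + 2) ^ 3 / (3 * real m)) \<le> (h4 / \<eta>)\<^sup>2 * D\<^sup>2 * \<eta>\<^sup>2"
    using \<open>0 < \<eta>\<close> \<open>0 < D\<close> by (simp add: power_divide h4_def power_mult_distrib)
  have "V x0 xstar \<le> D\<^sup>2"
    by fact
  note rates = rates[OF this[unfolded V_def] _ sq_le_1[OF h_nonneg(1) h_le(3)] _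
      sq_le_1[OF h_nonneg(2) h_le(4)] h_le(2)[unfolded h2_def] \<eta>2 \<eta>3]
  have "integrable M (\<lambda>\<omega>. V (z t \<omega>) xstar) \<and> (\<integral>\<omega>. V (z t \<omega>) xstar \<partial>M) \<le> 3 * D\<^sup>2" if "t \<in> {1..k}" for t
    unfolding V_def using integrable_iterates[of t] rates(1)[of t] that by simp
  moreover have "integrable M (\<lambda>\<omega>. f (x k \<omega>) - fstar)"
    using integrable_iterates[of k] by (simp add: value_gap_def[abs_def] fstar)
  moreover have "(\<integral>\<omega>. f (x k \<omega>) - fstar \<partial>M)
      \<le> 3 * \<eta> * (D\<^sup>2 * (1 + (h3 / \<eta>)\<^sup>2 + (h4 / \<eta>)\<^sup>2)) / ((real k + 1) * (real k + 2))"
    using rates(2) \<open>2 \<le> k\<close> by (simp add: value_gap_def[abs_def] fstar)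
  moreover have "\<dots> \<le> 12 * L * D\<^sup>2 / ((real k + 1) * (real k + 2))
      + 18 * \<L> * D\<^sup>2 / ((real k + 2) * real m)
      + 18 * D\<^sup>2 * sqrt (L * \<L>) / ((real k + 1) * sqrt (real m))
      + 4 * \<sigma> * D * sqrt 2 / sqrt ((real k + 1) * real m)"
    unfolding h3_def h4_def
    by (rule sagd_final_rate[OF assms(25,18,8,22,23,26,29,30)])
  ultimately show ?thesis
    by (meson order_trans)
qed

end
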